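(* Let $\alpha\neq 0$, $\beta$, $\gamma$ be real numbers and let $\varepsilon>0$. There exists a constant $C>0$, depending only on $\alpha,\beta,\gamma$ and $\varepsilon$, such that for all real numbers $a>1$ and $b>1$ the quantity $E_{\mathcal P}(a,b)$ defined by $$ \sum_{1\le x\le b}\left\lfloor \frac{\alpha x^2}{a}+\beta x+\gamma a\right\rfloor =\sum_{1\le x\le b}\left(\frac{\alpha x^2}{a}+\beta x+\gamma a-\frac12\right)+E_{\mathcal P}(a,b) $$ satisfies $$ \left|E_{\mathcal P}(a,b)\right|\le C\left(a^{\frac12}+b\,a^{-\frac12}\right)\exp\left(\frac{\left(\frac12\ln 2+\varepsilon\right)\log\Delta}{\log\log\Delta}\right), \qquad \Delta=\max\left(\frac{b^2a^{\frac12}}{a+b},\,3\right). $$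
   Context: Sums over $x$ run over integers $x$ in the indicated range. $\mathcal P$ denotes the parabola $y=\alpha x^2+\beta x+\gamma$. $\lfloor t\rfloor$ is the greatest integer not exceeding $t$; both $\log$ and $\ln$ denote the natural logarithm, and $\exp(x)=e^x$. *)

theory Defs
  imports Complex_Main
begin

text \<open>
  The parabola is \<open>y = \<alpha> x\<^sup>2 + \<beta> x + \<gamma>\<close>; the summand below is \<open>a\<close> times its ordinate at \<open>x / a\<close>,
  i.e. the ordinate over \<open>x\<close> of the parabola dilated by the factor \<open>a\<close>.
\<close>

definition dilated_parabola :: "real \<Rightarrow> real \<Rightarrow> real \<Rightarrow> real \<Rightarrow> real \<Rightarrow> real" where
  "dilated_parabola \<alpha> \<beta> \<gamma> a x = \<alpha> * x\<^sup>2 / a + \<beta> * x + \<gamma> * a"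

definition parabola_error :: "real \<Rightarrow> real \<Rightarrow> real \<Rightarrow> real \<Rightarrow> real \<Rightarrow> real" where
  "parabola_error \<alpha> \<beta> \<gamma> a b =
     (\<Sum>x | 1 \<le> x \<and> real_of_int x \<le> b. real_of_int \<lfloor>dilated_parabola \<alpha> \<beta> \<gamma> a (real_of_int x)\<rfloor>)
   - (\<Sum>x | 1 \<le> x \<and> real_of_int x \<le> b. dilated_parabola \<alpha> \<beta> \<gamma> a (real_of_int x) - 1 / 2)"

definition Delta :: "real \<Rightarrow> real \<Rightarrow> real" where
  "Delta a b = max (b\<^sup>2 * a powr (1 / 2) / (a + b)) 3"

end

theory Submission
  imports Defs "HOL-Analysis.Harmonic_Numbers" "HOL-Analysis.Convex" "HOL-Real_Asymp.Real_Asymp"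
begin

text \<open>
  Up to sign the error is the sum of the sawtooth \<open>\<psi>(t) = t - \<lfloor>t\<rfloor> - 1/2\<close> over the values of a
  quadratic polynomial \<open>f\<close> with leading coefficient \<open>\<alpha>/a\<close> at \<open>X = \<lfloor>b\<rfloor>\<close> consecutive integers. Put
  \<open>R = \<surd>a + b/\<surd>a = (a + b)/\<surd>a\<close>, so that the bound to be proved is \<open>R\<close> times the exponential factor, and
  \<open>\<Delta> = max (b\<^sup>2/R) 3\<close>.

  Expanding \<open>\<psi>\<close> in a Fourier series truncated at \<open>N = \<lfloor>b/R\<rfloor>\<close> costs \<open>X/N\<close>, hence \<open>R\<close>, up to a factor
  \<open>log N\<close> (\<open>sum_sawtooth_le\<close>), and leaves the sum of \<open>\<bar>S\<^sub>n\<bar>/n\<close> over \<open>n \<le> N\<close>, where \<open>S\<^sub>n\<close> is the exponential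
  sum with phase \<open>n f(x)\<close>. Individual bounds for \<open>S\<^sub>n\<close> are too weak, but the mean square is small. Weyl
  differencing bounds \<open>\<bar>S\<^sub>n\<bar>\<^sup>2\<close> by \<open>X\<close> plus a sum over \<open>0 < h < X\<close> of \<open>g(nh)\<close>, where
  \<open>g(m) = min X (1/\<bar>sin (\<pi>m\<theta>)\<bar>)\<close> and \<open>\<theta> = 2\<bar>\<alpha>\<bar>/a\<close>, because differencing a quadratic phase leaves geometric
  sums. In a sum over \<open>n\<close> and \<open>h\<close> every product \<open>m = nh\<close>, which is at most \<open>NX \<le> b\<^sup>2/R \<le> \<Delta>\<close>, occurs at most
  as often as \<open>m\<close> has divisors. The points \<open>m\<theta>\<close> have the fixed small spacing \<open>\<theta>\<close>, so they are evenly distributed modulo \<open>1\<close> and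
  few of them come close to an integer, which bounds the sum of \<open>g\<close> over an initial segment
  (\<open>sum_capped_inverse_sin_le\<close>). Altogether the sum of \<open>\<bar>S\<^sub>n\<bar>/n\<close> has square at most
  \<open>(log \<Delta>)\<^sup>3 R\<^sup>2\<close> times the maximum of the divisor function up to \<open>\<Delta>\<close>, up to a constant depending on \<open>\<alpha>\<close>.

  The divisor function is at most \<open>exp ((ln 2 + \<epsilon>) log \<Delta> / log log \<Delta>)\<close> up to a constant
  (\<open>card_divisors_le_exp\<close>); the square root taken after the Cauchy--Schwarz inequality turns \<open>ln 2\<close> into
  the constant \<open>(ln 2)/2\<close> of the theorem. Powers of \<open>log \<Delta>\<close> are absorbed by \<open>\<epsilon>\<close>. In the two
  ranges that this argument does not cover, \<open>a < 4\<bar>\<alpha>\<bar>\<close> (where \<open>\<theta>\<close> may exceed \<open>1/2\<close>) and \<open>b < R\<close> (where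
  \<open>N = 0\<close>), the trivial bound \<open>b\<close> for the error is already of order \<open>R\<close>.
\<close>

section \<open>Exponential sums\<close>

definition ee :: "real \<Rightarrow> complex" where
  "ee t = cis (2 * pi * t)"

lemma ee_add: "ee (s + t) = ee s * ee t"
  by (simp add: ee_def cis_mult algebra_simps)

lemma cnj_ee: "cnj (ee t) = ee (- t)"
  by (simp add: ee_def cis_cnj)

lemma norm_ee [simp]: "norm (ee t) = 1"
  by (simp add: ee_def)

lemma ee_of_nat_mult: "ee (of_nat n * t) = ee t ^ n"
  by (simp add: ee_def Complex.DeMoivre algebra_simps)

lemma ee_of_int [simp]: "ee (of_int k) = 1"
  by (simp add: ee_def cis_multiple_2pi)

lemma norm_1_minus_ee: "norm (1 - ee t) = 2 * \<bar>sin (pi * t)\<bar>"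
proof -
  have "(norm (1 - ee t))\<^sup>2 = (1 - cos (2 * (pi * t)))\<^sup>2 + (sin (2 * (pi * t)))\<^sup>2"
    by (simp add: cmod_power2 ee_def algebra_simps)
  also have "\<dots> = 2 - 2 * cos (2 * (pi * t))"
    using sin_cos_squared_add[of "2 * (pi * t)"] by (simp add: power2_eq_square algebra_simps)
  also have "\<dots> = (2 * \<bar>sin (pi * t)\<bar>)\<^sup>2"
    by (simp add: cos_double_sin power2_eq_square)
  finally show ?thesis
    by (rule power2_eq_imp_eq) auto
qed

lemma norm_sum_ee_le:
  assumes "sin (pi * t) \<noteq> 0"
  shows "norm (\<Sum>x<n. ee (real x * t)) \<le> 1 / \<bar>sin (pi * t)\<bar>"
proof -
  have "(1 - ee t) * (\<Sum>x<n. ee (real x * t)) = 1 - ee t ^ n"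
    by (simp add: ee_of_nat_mult one_diff_power_eq)
  hence "norm (1 - ee t) * norm (\<Sum>x<n. ee (real x * t)) = norm (1 - ee t ^ n)"
    by (metis norm_mult)
  also have "\<dots> \<le> 2"
    using norm_triangle_ineq4[of 1 "ee t ^ n"] by (simp add: norm_power)
  finally show ?thesis
    using assms by (simp add: norm_1_minus_ee field_simps)
qed

text \<open>
  Jordan's inequality: by concavity the sine lies above its chord on \<open>[0, \<pi>/2]\<close>.
\<close>

lemma abs_sin_pi_ge:
  assumes "\<bar>t\<bar> \<le> 1 / 2"
  shows "2 * \<bar>t\<bar> \<le> \<bar>sin (pi * t)\<bar>"
proof -
  have *: "2 * t \<le> sin (pi * t)" if "0 \<le> t" "t \<le> 1 / 2" for t :: real
  proof -
    have "convex_on {0..pi/2} (\<lambda>x. - sin x)"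
    proof (rule f''_ge0_imp_convex)
      show "((\<lambda>x. - sin x) has_real_derivative - cos x) (at x)" for x :: real
        by (auto intro!: derivative_eq_intros)
      show "((\<lambda>x. - cos x) has_real_derivative sin x) (at x)" for x :: real
        by (auto intro!: derivative_eq_intros)
      show "sin x \<ge> 0" if "x \<in> {0..pi/2}" for x :: real
        using that pi_gt_zero by (intro sin_ge_zero) (auto simp del: pi_gt_zero)
    qed auto
    from convex_onD[OF this, of "2 * t" 0 "pi / 2"] show ?thesis
      using that by (simp add: field_simps)
  qed
  show ?thesis
    using *[of "\<bar>t\<bar>"] assms by (cases "t \<ge> 0") auto
qed

text \<open>
  This identity is used twice: with \<open>z x = e(xt)\<close> it is the Fourier expansion of the Fejer kernel, and with a
  quadratic phase it is the differencing step of Weyl and van der Corput.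
\<close>

lemma norm_sum_power2_eq_correlations:
  fixes z :: "nat \<Rightarrow> complex"
  assumes "\<And>x. norm (z x) = 1"
  shows "(norm (\<Sum>x<n. z x))\<^sup>2 = n + 2 * Re (\<Sum>h = 1..<n. \<Sum>x<n - h. z (x + h) * cnj (z x))"
proof (induction n)
  case (Suc n)
  let ?S = "\<Sum>x<n. z x"
  have nz: "(norm (z n))\<^sup>2 = 1" using assms by simp
  have "(norm (\<Sum>x<Suc n. z x))\<^sup>2 = (norm ?S)\<^sup>2 + 1 + 2 * Re (z n * cnj ?S)"
    using nz unfolding cmod_power2 by (simp add: power2_eq_square algebra_simps sum_negf)
  also have "z n * cnj ?S = (\<Sum>x<n. z n * cnj (z x))"
    by (simp add: sum_distrib_left)
  also have "\<dots> = (\<Sum>h = 1..<Suc n. z n * cnj (z (n - h)))"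
    by (rule sum.reindex_bij_witness[of _ "\<lambda>h. n - h" "\<lambda>x. n - x"]) auto
  finally have *: "(norm (\<Sum>x<Suc n. z x))\<^sup>2 = (norm ?S)\<^sup>2 + 1 + 2 * Re \<dots>" .
  have "(\<Sum>h = 1..<Suc n. \<Sum>x<Suc n - h. z (x + h) * cnj (z x))
      = (\<Sum>h = 1..<Suc n. (\<Sum>x<n - h. z (x + h) * cnj (z x)) + z n * cnj (z (n - h)))"
    by (intro sum.cong) (auto simp: Suc_diff_le)
  also have "\<dots> = (\<Sum>h = 1..<n. \<Sum>x<n - h. z (x + h) * cnj (z x)) + (\<Sum>h = 1..<Suc n. z n * cnj (z (n - h)))"
    by (cases n) (auto simp: sum.distrib)
  finally show ?case using * Suc by simp
qed simp

section \<open>A truncated Fourier expansion of the sawtooth\<close>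

definition sawtooth :: "real \<Rightarrow> real" where
  "sawtooth t = t - of_int \<lfloor>t\<rfloor> - 1 / 2"

lemma sum_cos_eq_dirichlet:
  assumes "sin (pi * t) \<noteq> 0"
  shows "1 + 2 * (\<Sum>n = 1..N. cos (2 * pi * real n * t)) = sin (real (2 * N + 1) * pi * t) / sin (pi * t)"
proof (induction N)
  case (Suc N)
  have "sin (real (2 * Suc N + 1) * pi * t) - sin (real (2 * N + 1) * pi * t)
      = 2 * sin (pi * t) * cos (2 * pi * real (Suc N) * t)"
    by (subst sin_diff_sin) (simp add: algebra_simps add_divide_distrib)
  thus ?case using Suc assms by (simp add: field_simps)
qed (use assms in simp)

text \<open>
  The remainder \<open>G\<close> has the Dirichlet kernel \<open>sin (M\<pi>t) / sin (\<pi>t)\<close> as its derivative and vanishes at \<open>1/2\<close>.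
  Instead of integrating that kernel by parts, one adds to \<open>G\<close> the boundary term
  \<open>(cos (M\<pi>t) + s) / (M\<pi> sin (\<pi>t))\<close>: the Dirichlet kernel cancels in the derivative, and for \<open>s = 1\<close>
  the sum is decreasing, for \<open>s = -1\<close> increasing. Comparing with the values at \<open>1/2\<close> bounds \<open>G\<close> from
  both sides.
\<close>

lemma sawtooth_fourier_remainder_le_csc:
  fixes N :: nat and t :: real
  assumes "0 < t" "t \<le> 1 / 2"
  defines "M \<equiv> real (2 * N + 1)"
  defines "G \<equiv> (\<lambda>t. t - 1 / 2 + (\<Sum>n = 1..N. sin (2 * pi * real n * t) / (pi * real n)))"
  shows "\<bar>G t\<bar> \<le> 2 / (M * pi * sin (pi * t))"
proof -
  have M: "M > 0" by (simp add: M_def)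
  have sin_pos: "sin (pi * u) > 0" if "t \<le> u" "u \<le> 1/2" for u
  proof (rule sin_gt_zero)
    show "0 < pi * u" using assms that by simp
    have "pi * u \<le> pi * (1/2)" using that by (intro mult_left_mono) auto
    thus "pi * u < pi" using pi_gt_zero by linarith
  qed
  have cos_nn: "cos (pi * u) \<ge> 0" if "t \<le> u" "u \<le> 1/2" for u
  proof (rule cos_ge_zero)
    have "0 \<le> pi * u" using assms that by simp
    thus "-(pi/2) \<le> pi * u" using pi_gt_zero by linarith
    have "pi * u \<le> pi * (1/2)" using that by (intro mult_left_mono) auto
    thus "pi * u \<le> pi / 2" by simp
  qed
  have dG: "(G has_real_derivative sin (M * pi * u) / sin (pi * u)) (at u)"
    if "t \<le> u" "u \<le> 1/2" for u
  proof -
    have "(G has_real_derivative 1 + (\<Sum>n = 1..N. cos (2 * pi * real n * u) * (2 * pi * real n) / (pi * real n))) (at u)"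
      unfolding G_def by (auto intro!: derivative_eq_intros sum.cong)
    also have "(\<Sum>n = 1..N. cos (2 * pi * real n * u) * (2 * pi * real n) / (pi * real n))
       = 2 * (\<Sum>n = 1..N. cos (2 * pi * real n * u))"
      unfolding sum_distrib_left by (rule sum.cong) auto
    also have "1 + \<dots> = sin (M * pi * u) / sin (pi * u)"
      unfolding M_def by (rule sum_cos_eq_dirichlet) (use sin_pos[OF that] in auto)
    finally show ?thesis .
  qed
  have dH: "((\<lambda>u. G u + (cos (M * pi * u) + s) / (M * pi * sin (pi * u))) has_real_derivative
      - ((cos (M * pi * u) + s) * cos (pi * u) / (M * (sin (pi * u))\<^sup>2))) (at u)"
    if u: "t \<le> u" "u \<le> 1/2" for u s
    using sin_pos[OF u] M
    by (auto intro!: derivative_eq_intros dG[OF u] simp: field_simps power2_eq_square)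
  \<comment> \<open>\<open>M\<close> is odd, so the oscillating part of the boundary term vanishes at \<open>1/2\<close>.\<close>
  have half: "cos (M * pi * (1/2)) = 0"
    by (simp add: M_def cos_zero_iff) (rule disjI1, rule exI[of _ "2*N+1"], simp)
  have Ghalf: "G (1/2) = 0"
  proof -
    have "sin (2 * pi * real n * (1/2)) = 0" for n
      using sin_npi[of n] by (simp add: mult.commute)
    thus ?thesis unfolding G_def by simp
  qed
  define c where "c = 1 / (M * pi)"
  have sin_half: "x / (M * pi * sin (pi * (1/2))) = x * c" for x
    by (simp add: c_def)
  have half_nonneg: "0 \<le> c" using M by (simp add: c_def)
  have nn: "(cos (M * pi * u) + 1) * cos (pi * u) / (M * (sin (pi * u))\<^sup>2) \<ge> 0"
           "(cos (M * pi * u) - 1) * cos (pi * u) / (M * (sin (pi * u))\<^sup>2) \<le> 0"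
    if "t \<le> u" "u \<le> 1/2" for u
  proof -
    have "cos (M * pi * u) + 1 \<ge> 0"
      using cos_ge_minus_one[of "M * pi * u"] by linarith
    thus "(cos (M * pi * u) + 1) * cos (pi * u) / (M * (sin (pi * u))\<^sup>2) \<ge> 0"
      using M cos_nn[OF that] by (intro divide_nonneg_nonneg mult_nonneg_nonneg) auto
    show "(cos (M * pi * u) - 1) * cos (pi * u) / (M * (sin (pi * u))\<^sup>2) \<le> 0"
      using M cos_nn[OF that] cos_le_one[of "M * pi * u"]
      by (intro divide_nonpos_nonneg mult_nonpos_nonneg) auto
  qed
  have "G (1/2) + (cos (M * pi * (1/2)) + 1) / (M * pi * sin (pi * (1/2)))
     \<le> G t + (cos (M * pi * t) + 1) / (M * pi * sin (pi * t))"
    by (rule DERIV_nonpos_imp_nonincreasing[OF assms(2)])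
       (intro exI conjI, rule dH, assumption, assumption, use nn(1) in simp)
  hence "c \<le> G t + (cos (M * pi * t) + 1) / (M * pi * sin (pi * t))"
    by (simp only: half Ghalf sin_half add_0 mult_1_left)
  with half_nonneg have "0 \<le> G t + (cos (M * pi * t) + 1) / (M * pi * sin (pi * t))"
    by (rule order_trans)
  moreover have "(cos (M * pi * t) + 1) / (M * pi * sin (pi * t)) \<le> 2 / (M * pi * sin (pi * t))"
    using M sin_pos[of t] assms by (intro divide_right_mono) auto
  moreover have "G t + (cos (M * pi * t) + (-1)) / (M * pi * sin (pi * t))
     \<le> G (1/2) + (cos (M * pi * (1/2)) + (-1)) / (M * pi * sin (pi * (1/2)))"
    by (rule DERIV_nonneg_imp_nondecreasing[OF assms(2)])
       (intro exI conjI, rule dH, assumption, assumption, use nn(2) in simp)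
  hence "G t + (cos (M * pi * t) - 1) / (M * pi * sin (pi * t)) \<le> - c"
    by (simp only: half Ghalf sin_half add_0 diff_0 mult_minus1 add_uminus_conv_diff)
  hence "G t + (cos (M * pi * t) - 1) / (M * pi * sin (pi * t)) \<le> 0"
    by (rule order_trans) (use half_nonneg in simp)
  moreover have "(1 - cos (M * pi * t)) / (M * pi * sin (pi * t)) \<le> 2 / (M * pi * sin (pi * t))"
    using M sin_pos[of t] assms cos_ge_minus_one[of "M * pi * t"]
    by (intro divide_right_mono) auto
  moreover have "(cos (M * pi * t) - 1) / (M * pi * sin (pi * t)) = - ((1 - cos (M * pi * t)) / (M * pi * sin (pi * t)))"
    by (simp add: diff_divide_distrib)
  ultimately show ?thesis by linarith
qed

lemma sawtooth_add_of_int: "sawtooth (t + of_int k) = sawtooth t"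
  by (simp add: sawtooth_def)

lemma sawtooth_fourier_remainder_le_1:
  assumes "N > 0" "\<bar>t\<bar> \<le> 1 / (12 * real N)"
  shows "\<bar>sawtooth t + (\<Sum>n = 1..N. sin (2 * pi * real n * t) / (pi * real n))\<bar> \<le> 1"
proof -
  have "\<bar>sin (2 * pi * real n * t) / (pi * real n)\<bar> \<le> 2 * \<bar>t\<bar>" if "n \<in> {1..N}" for n
    using that abs_sin_x_le_abs_x[of "2 * pi * real n * t"]
    by (simp add: abs_mult field_simps)
  hence "\<bar>\<Sum>n = 1..N. sin (2 * pi * real n * t) / (pi * real n)\<bar> \<le> (\<Sum>n = 1..N. 2 * \<bar>t\<bar>)"
    by (intro order_trans[OF sum_abs] sum_mono) auto
  also have "\<dots> \<le> 1 / 6"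
    using assms by (simp add: field_simps)
  finally have "\<bar>\<Sum>n = 1..N. sin (2 * pi * real n * t) / (pi * real n)\<bar> \<le> 1 / 6" .
  moreover have "\<bar>sawtooth t\<bar> \<le> 1 / 2"
    unfolding sawtooth_def by linarith
  ultimately show ?thesis by linarith
qed

text \<open>
  The sum of the Fejer kernels of order \<open>H \<le> N\<close>, each divided by its maximum \<open>H\<close>. It is a nonnegative
  trigonometric polynomial of degree below \<open>N\<close> which, up to a constant, dominates \<open>min N (1/\<bar>t\<bar>)\<close> for
  \<open>\<bar>t\<bar> \<le> 1/2\<close>, while its Fourier coefficients are only of size \<open>log N\<close>.
\<close>

definition fejer_majorant :: "nat \<Rightarrow> real \<Rightarrow> real" where
  "fejer_majorant N t = (\<Sum>H = 1..N. (norm (\<Sum>j<H. ee (real j * t)))\<^sup>2 / (real H)\<^sup>2)"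

text \<open>
  For \<open>K \<le> H\<close> the numbers \<open>jt\<close> with \<open>j < K\<close> have modulus at most \<open>1/6\<close>, so the terms of the \<open>K\<close>-th inner sum have
  real part at least \<open>1/2\<close> and do not cancel.
\<close>

lemma fejer_majorant_ge:
  assumes "H \<ge> 1" "H \<le> N" "\<bar>t\<bar> \<le> 1 / (6 * real H)"
  shows "real H / 4 \<le> fejer_majorant N t"
proof -
  have *: "1 / 4 \<le> (norm (\<Sum>j<K. ee (real j * t)))\<^sup>2 / (real K)\<^sup>2" if K: "K \<in> {1..H}" for K
  proof -
    have "real K * (1 / 2) \<le> (\<Sum>j<K. cos (2 * pi * (real j * t)))"
    proof -
      have "1 / 2 \<le> cos (2 * pi * (real j * t))" if "j < K" for j
      proof -
        have "real j * \<bar>t\<bar> \<le> real H * (1 / (6 * real H))"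
          using that K assms by (intro mult_mono) auto
        also have "\<dots> = 1 / 6" using assms by simp
        finally have "\<bar>2 * pi * (real j * t)\<bar> \<le> pi / 3"
          by (simp add: abs_mult field_simps)
        hence "cos (pi / 3) \<le> cos \<bar>2 * pi * (real j * t)\<bar>"
          using pi_gt_zero by (intro cos_monotone_0_pi_le) (auto simp del: pi_gt_zero)
        thus ?thesis by (simp add: cos_60)
      qed
      hence "(\<Sum>j<K. 1 / 2) \<le> (\<Sum>j<K. cos (2 * pi * (real j * t)))"
        by (intro sum_mono) auto
      thus ?thesis by simp
    qed
    also have "\<dots> = Re (\<Sum>j<K. ee (real j * t))"
      by (simp add: ee_def)
    also have "\<dots> \<le> norm (\<Sum>j<K. ee (real j * t))"
      by (rule complex_Re_le_cmod)
    finally have "(real K * (1 / 2))\<^sup>2 \<le> (norm (\<Sum>j<K. ee (real j * t)))\<^sup>2"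
      by (intro power_mono) auto
    thus ?thesis using K by (simp add: field_simps power2_eq_square)
  qed
  have "real H / 4 = (\<Sum>K = 1..H. 1 / 4)" by simp
  also have "\<dots> \<le> (\<Sum>K = 1..H. (norm (\<Sum>j<K. ee (real j * t)))\<^sup>2 / (real K)\<^sup>2)"
    using * by (intro sum_mono) auto
  also have "\<dots> \<le> fejer_majorant N t"
    unfolding fejer_majorant_def using assms by (intro sum_mono2) auto
  finally show ?thesis .
qed

text \<open>
  Up to a constant the remainder is at most \<open>min 1 (1/(Nt))\<close>: the trivial bound serves for \<open>t\<close> below
  \<open>1/(12N)\<close>, the cosecant bound above. In both ranges the kernel of order \<open>1\<close> and those of order at most
  \<open>min N (1/(6t))\<close> make \<open>fejer_majorant N t\<close> at least a multiple of \<open>min N (1/t)\<close>.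
\<close>

lemma sawtooth_fourier_0_half:
  assumes N: "N > 0" and t: "0 \<le> t" "t \<le> 1 / 2"
  shows "\<bar>sawtooth t + (\<Sum>n = 1..N. sin (2 * pi * real n * t) / (pi * real n))\<bar>
    \<le> 8 / real N * fejer_majorant N t"
proof (cases "t \<le> 1 / (12 * real N)")
  case True
  have "1 / (12 * real N) \<le> 1 / (6 * real N)"
    using N by (simp add: field_simps)
  hence "real N / 4 \<le> fejer_majorant N t"
    using True t N by (intro fejer_majorant_ge) auto
  hence "1 \<le> 8 / real N * fejer_majorant N t"
    using N by (simp add: field_simps)
  thus ?thesis
    using sawtooth_fourier_remainder_le_1[of N t] True t N by (smt (verit))
next
  case False
  have t0: "t > 0" using False N by (smt (verit) divide_nonneg_nonneg of_nat_0_le_iff)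
  have le: "1 / (12 * t) \<le> 4 * fejer_majorant N t"
  proof (cases "1 / (6 * t) < 1")
    case True
    have "1 \<le> 4 * fejer_majorant N t"
    proof -
      have "(norm (\<Sum>j<1::nat. ee (real j * t)))\<^sup>2 / (real 1)\<^sup>2 \<le> fejer_majorant N t"
        unfolding fejer_majorant_def
        by (rule member_le_sum[where f = "\<lambda>H. (norm (\<Sum>j<H. ee (real j * t)))\<^sup>2 / (real H)\<^sup>2"])
           (use N in auto)
      thus ?thesis by simp
    qed
    moreover have "1 / (12 * t) \<le> 1"
      using True t0 by (simp add: field_simps)
    ultimately show ?thesis by linarith
  next
    case False
    define H where "H = nat \<lfloor>1 / (6 * t)\<rfloor>"
    have H: "real H \<le> 1 / (6 * t)" "1 / (6 * t) < real H + 1" "H \<ge> 1"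
      using False t0 unfolding H_def by (auto simp: le_nat_iff le_floor_iff)
    have Ht: "t \<le> 1 / (6 * real H)"
      using H(1,3) t0 by (simp add: field_simps)
    have half: "1 / (12 * t) \<le> real H"
    proof -
      have "1 / (12 * t) = (1 / (6 * t)) / 2" using t0 by (simp add: field_simps)
      moreover have "real H \<ge> 1" using H(3) by simp
      ultimately show ?thesis using H(2) by linarith
    qed
    show ?thesis
    proof (cases "H \<le> N")
      case True
      from fejer_majorant_ge[OF H(3) this, of t] Ht t half show ?thesis by simp
    next
      case False
      have "1 / (6 * real H) \<le> 1 / (6 * real N)"
        using False N by (intro divide_left_mono) auto
      hence "real N / 4 \<le> fejer_majorant N t"
        using fejer_majorant_ge[of N N t] N Ht t by auto
      moreover have "1 / (12 * t) \<le> real N"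
        using \<open>\<not> t \<le> 1 / (12 * real N)\<close> t0 N by (simp add: field_simps)
      ultimately show ?thesis by simp
    qed
  qed
  have "sawtooth t = t - 1 / 2"
    unfolding sawtooth_def using t by (simp add: floor_eq_iff)
  hence "\<bar>sawtooth t + (\<Sum>n = 1..N. sin (2 * pi * real n * t) / (pi * real n))\<bar>
      \<le> 2 / (real (2 * N + 1) * pi * sin (pi * t))"
    using sawtooth_fourier_remainder_le_csc[of t N] t0 t by simp
  also have "\<dots> \<le> 2 / (2 * real N * 3 * (2 * t))"
  proof -
    have "2 * t \<le> sin (pi * t)"
      using abs_sin_pi_ge[of t] t sin_ge_zero[of "pi * t"] mult_left_mono[of t 1 pi] by simp
    moreover have "pi > 3" using pi_gt3 by simp
    ultimately show ?thesis
      using t0 N by (intro divide_left_mono mult_mono mult_pos_pos) auto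
  qed
  also have "\<dots> = 2 / real N * (1 / (12 * t))" using t0 N by (simp add: field_simps)
  also have "\<dots> \<le> 2 / real N * (4 * fejer_majorant N t)"
    by (intro mult_left_mono le) auto
  finally show ?thesis by simp
qed

lemma sin_2pi_add_int: "sin (2 * pi * real n * (t + of_int k)) = sin (2 * pi * real n * t)"
proof -
  have "sin (2 * pi * real n * (t + of_int k)) = sin (2 * pi * real n * t + 2 * pi * of_int (int n * k))"
    by (simp add: algebra_simps)
  also have "\<dots> = sin (2 * pi * real n * t)"
    by (subst sin_add) (use sin_int_2pin[of "int n * k"] cos_int_2pin[of "int n * k"] in simp)
  finally show ?thesis .
qed

lemma fejer_majorant_add_of_int: "fejer_majorant N (t + of_int k) = fejer_majorant N t"
proof -
  have "ee (real j * (t + of_int k)) = ee (real j * t)" for j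
    using ee_add[of "real j * t" "of_int (int j * k)"] ee_of_int[of "int j * k"]
    by (simp add: algebra_simps)
  thus ?thesis by (simp add: fejer_majorant_def)
qed

lemma fejer_majorant_minus: "fejer_majorant N (- t) = fejer_majorant N t"
proof -
  have "norm (\<Sum>j<H. ee (real j * (- t))) = norm (\<Sum>j<H. ee (real j * t))" for H
  proof -
    have "(\<Sum>j<H. ee (real j * (- t))) = cnj (\<Sum>j<H. ee (real j * t))"
      by (simp add: cnj_ee)
    thus ?thesis by (metis complex_mod_cnj)
  qed
  thus ?thesis by (simp add: fejer_majorant_def)
qed

lemma sawtooth_fourier:
  assumes N: "N > 0"
  shows "\<bar>sawtooth t + (\<Sum>n = 1..N. sin (2 * pi * real n * t) / (pi * real n))\<bar>
    \<le> 8 / real N * fejer_majorant N t"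
proof -
  define u where "u = t - of_int (round t)"
  have t: "t = u + of_int (round t)" by (simp add: u_def)
  have u: "\<bar>u\<bar> \<le> 1 / 2" unfolding u_def using of_int_round_abs_le[of t] by linarith
  have "\<bar>sawtooth u + (\<Sum>n = 1..N. sin (2 * pi * real n * u) / (pi * real n))\<bar>
    \<le> 8 / real N * fejer_majorant N u"
  proof (cases "u \<ge> 0")
    case True
    thus ?thesis using sawtooth_fourier_0_half[OF N, of u] u by simp
  next
    case False
    have "\<lfloor>- u\<rfloor> = 0" "\<lfloor>u\<rfloor> = -1"
      using False u by (auto simp: floor_eq_iff)
    hence "sawtooth (- u) = - sawtooth u"
      by (simp add: sawtooth_def)
    moreover have "(\<Sum>n = 1..N. sin (2 * pi * real n * (- u)) / (pi * real n))
        = - (\<Sum>n = 1..N. sin (2 * pi * real n * u) / (pi * real n))"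
      by (simp add: sum_negf)
    ultimately show ?thesis
      using sawtooth_fourier_0_half[OF N, of "- u"] u False
      by (simp add: fejer_majorant_minus)
  qed
  thus ?thesis
    by (subst (1 2 3) t) (simp only: sawtooth_add_of_int sin_2pi_add_int fejer_majorant_add_of_int)
qed

text \<open>
  Expanding each Fejer kernel as a trigonometric polynomial and interchanging the summations turns the sum over
  \<open>x\<close> into exponential sums; the coefficient of each of them is at most \<open>1/H\<close>, and the constant
  term \<open>1/H\<close> contributes \<open>X/H\<close>.
\<close>

lemma sum_fejer_majorant_le:
  fixes f :: "nat \<Rightarrow> real"
  shows "(\<Sum>x<X. fejer_majorant N (f x)) \<le>
     harm N * (real X + 2 * (\<Sum>n = 1..N. norm (\<Sum>x<X. ee (real n * f x))))"
proof -
  define S where "S = (\<lambda>n. \<Sum>x<X. ee (real n * f x))"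
  have *: "(\<Sum>x<X. (norm (\<Sum>j<H. ee (real j * f x)))\<^sup>2) \<le> real H * (real X + 2 * (\<Sum>n = 1..N. norm (S n)))"
    if H: "H \<in> {1..N}" for H
  proof -
    have eq: "(\<Sum>h = 1..<H. \<Sum>x<H - h. ee (real (x + h) * t) * cnj (ee (real x * t)))
        = (\<Sum>h = 1..<H. of_nat (H - h) * ee (real h * t))" for t
      by (intro sum.cong) (auto simp: cnj_ee ee_add[symmetric] algebra_simps)
    have "(\<Sum>x<X. (norm (\<Sum>j<H. ee (real j * f x)))\<^sup>2)
       = (\<Sum>x<X. real H + 2 * Re (\<Sum>h = 1..<H. of_nat (H - h) * ee (real h * f x)))"
      by (subst norm_sum_power2_eq_correlations) (simp_all only: norm_ee eq)
    also have "\<dots> = real X * real H + 2 * Re (\<Sum>x<X. \<Sum>h = 1..<H. of_nat (H - h) * ee (real h * f x))"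
      by (simp add: sum.distrib sum_distrib_left)
    also have "(\<Sum>x<X. \<Sum>h = 1..<H. of_nat (H - h) * ee (real h * f x)) = (\<Sum>h = 1..<H. of_nat (H - h) * S h)"
      unfolding S_def sum_distrib_left by (rule sum.swap)
    also have "Re \<dots> \<le> norm \<dots>" by (rule complex_Re_le_cmod)
    also have "norm (\<Sum>h = 1..<H. of_nat (H - h) * S h) \<le> (\<Sum>h = 1..<H. real H * norm (S h))"
      by (intro sum_norm_le) (auto simp: norm_mult simp del: of_nat_diff intro!: mult_right_mono)
    also have "\<dots> \<le> (\<Sum>h = 1..N. real H * norm (S h))"
      using H by (intro sum_mono2) auto
    finally show ?thesis by (simp add: sum_distrib_left algebra_simps)
  qed
  have "(\<Sum>x<X. fejer_majorant N (f x)) =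
      (\<Sum>H = 1..N. (\<Sum>x<X. (norm (\<Sum>j<H. ee (real j * f x)))\<^sup>2) / (real H)\<^sup>2)"
    unfolding fejer_majorant_def sum_divide_distrib by (rule sum.swap)
  also have "\<dots> \<le> (\<Sum>H = 1..N. real H * (real X + 2 * (\<Sum>n = 1..N. norm (S n))) / (real H)\<^sup>2)"
    by (intro sum_mono divide_right_mono *) auto
  also have "\<dots> = (\<Sum>H = 1..N. inverse (real H) * (real X + 2 * (\<Sum>n = 1..N. norm (S n))))"
    by (intro sum.cong) (auto simp: power2_eq_square field_simps)
  also have "\<dots> = harm N * (real X + 2 * (\<Sum>n = 1..N. norm (S n)))"
    by (simp add: harm_def sum_distrib_right)
  finally show ?thesis unfolding S_def .
qed

text \<open>
  An inequality of Erdos--Turan type. The logarithmic factor \<open>harm N\<close> is the price for using a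
  sum of Fejer kernels in place of an extremal majorant.
\<close>

lemma sum_sawtooth_le:
  fixes f :: "nat \<Rightarrow> real"
  assumes N: "N > 0"
  shows "\<bar>\<Sum>x<X. sawtooth (f x)\<bar> \<le>
     (1 + 16 * harm N) * (\<Sum>n = 1..N. norm (\<Sum>x<X. ee (real n * f x)) / real n)
       + 8 * harm N * real X / real N"
proof -
  define S where "S = (\<lambda>n. \<Sum>x<X. ee (real n * f x))"
  define g where "g = (\<lambda>x. \<Sum>n = 1..N. sin (2 * pi * real n * f x) / (pi * real n))"
  have "\<bar>\<Sum>x<X. g x\<bar> \<le> (\<Sum>n = 1..N. norm (S n) / real n)"
  proof -
    have "(\<Sum>x<X. g x) = (\<Sum>n = 1..N. Im (S n) / (pi * real n))"
      unfolding g_def S_def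
      by (subst sum.swap) (simp add: ee_def sum_divide_distrib mult.assoc)
    also have "\<bar>\<dots>\<bar> \<le> (\<Sum>n = 1..N. \<bar>Im (S n) / (pi * real n)\<bar>)"
      by (rule sum_abs)
    also have "\<dots> \<le> (\<Sum>n = 1..N. norm (S n) / real n)"
    proof (rule sum_mono)
      fix n assume n: "n \<in> {1..N}"
      have "\<bar>Im (S n)\<bar> / (pi * real n) \<le> norm (S n) / (1 * real n)"
        using n pi_gt3 abs_Im_le_cmod[of "S n"] by (intro frac_le mult_mono) auto
      thus "\<bar>Im (S n) / (pi * real n)\<bar> \<le> norm (S n) / real n"
        by simp
    qed
    finally show ?thesis .
  qed
  moreover have "\<bar>\<Sum>x<X. sawtooth (f x) + g x\<bar> \<le>
      16 * harm N * (\<Sum>n = 1..N. norm (S n) / real n) + 8 * harm N * real X / real N"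
  proof -
    have "\<bar>\<Sum>x<X. sawtooth (f x) + g x\<bar> \<le> (\<Sum>x<X. 8 / real N * fejer_majorant N (f x))"
      unfolding g_def by (intro order_trans[OF sum_abs] sum_mono sawtooth_fourier N)
    also have "\<dots> = 8 / real N * (\<Sum>x<X. fejer_majorant N (f x))"
      by (simp add: sum_distrib_left)
    also have "\<dots> \<le> 8 / real N * (harm N * (real X + 2 * (\<Sum>n = 1..N. norm (S n))))"
      unfolding S_def by (intro mult_left_mono sum_fejer_majorant_le) auto
    also have "\<dots> = 16 * harm N * ((\<Sum>n = 1..N. norm (S n)) / real N) + 8 * harm N * real X / real N"
      by (simp add: add_divide_distrib distrib_left)
    also have "(\<Sum>n = 1..N. norm (S n)) / real N \<le> (\<Sum>n = 1..N. norm (S n) / real n)"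
      unfolding sum_divide_distrib by (intro sum_mono divide_left_mono) auto
    finally show ?thesis by (simp add: mult_left_mono harm_nonneg)
  qed
  moreover have "(\<Sum>x<X. sawtooth (f x)) = (\<Sum>x<X. sawtooth (f x) + g x) - (\<Sum>x<X. g x)"
    by (simp add: sum.distrib)
  ultimately show ?thesis
    unfolding S_def by (simp add: algebra_simps)
qed

section \<open>Weyl differencing for quadratic phases\<close>

text \<open>
  The minimum of \<open>X\<close> and \<open>1/\<bar>sin (\<pi>t)\<bar>\<close>. The case distinction avoids the convention \<open>1/0 = 0\<close>, which would
  give the minimum the wrong value at integers \<open>t\<close>.
\<close>

definition capped_inverse_sin :: "nat \<Rightarrow> real \<Rightarrow> real" where
  "capped_inverse_sin X t = (if real X * \<bar>sin (pi * t)\<bar> \<le> 1 then real X else 1 / \<bar>sin (pi * t)\<bar>)"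

lemma capped_inverse_sin_nonneg: "capped_inverse_sin X t \<ge> 0"
  by (simp add: capped_inverse_sin_def)

lemma capped_inverse_sin_le_cap: "capped_inverse_sin X t \<le> real X"
proof (cases "real X * \<bar>sin (pi * t)\<bar> \<le> 1")
  case False
  hence "\<bar>sin (pi * t)\<bar> > 0" by auto
  with False show ?thesis by (simp add: capped_inverse_sin_def divide_le_eq)
qed (simp add: capped_inverse_sin_def)

lemma capped_inverse_sin_le_inverse:
  "sin (pi * t) \<noteq> 0 \<Longrightarrow> capped_inverse_sin X t \<le> 1 / \<bar>sin (pi * t)\<bar>"
  by (auto simp: capped_inverse_sin_def field_simps)

lemma capped_inverse_sin_minus: "capped_inverse_sin X (- t) = capped_inverse_sin X t"
  by (simp add: capped_inverse_sin_def)

lemma capped_inverse_sin_add_of_int: "capped_inverse_sin X (t + of_int k) = capped_inverse_sin X t"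
proof -
  have "norm (1 - ee (t + of_int k)) = norm (1 - ee t)"
    by (simp add: ee_add)
  thus ?thesis by (simp add: norm_1_minus_ee capped_inverse_sin_def)
qed

lemma norm_sum_ee_le_capped:
  assumes "n \<le> X"
  shows "norm (\<Sum>x<n. ee (real x * t)) \<le> capped_inverse_sin X t"
proof (cases "real X * \<bar>sin (pi * t)\<bar> \<le> 1")
  case True
  have "norm (\<Sum>x<n. ee (real x * t)) \<le> (\<Sum>x<n. 1)"
    by (intro sum_norm_le) auto
  with assms True show ?thesis by (simp add: capped_inverse_sin_def)
next
  case False
  hence "sin (pi * t) \<noteq> 0" by auto
  from norm_sum_ee_le[OF this, of n] False show ?thesis by (simp add: capped_inverse_sin_def)
qed

text \<open>
  The difference \<open>f(x + h) - f(x)\<close> is linear in \<open>x\<close> with slope \<open>2Ah\<close>, so every correlation of the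
  phases is a geometric sum. Its bound depends on \<open>n\<close> and \<open>h\<close> only through the product \<open>nh\<close>.
\<close>

lemma weyl_differencing_quadratic:
  fixes A B D :: real
  defines "f \<equiv> (\<lambda>x::nat. A * (real x)\<^sup>2 + B * real x + D)"
  shows "(norm (\<Sum>x<X. ee (real n * f x)))\<^sup>2 \<le>
    real X + 2 * (\<Sum>h = 1..<X. capped_inverse_sin X (real (n * h) * (2 * A)))"
proof -
  have "norm (\<Sum>x<X - h. ee (real n * f (x + h)) * cnj (ee (real n * f x)))
      \<le> capped_inverse_sin X (real (n * h) * (2 * A))" for h
  proof -
    have "ee (real n * f (x + h)) * cnj (ee (real n * f x))
        = ee (real n * (A * (real h)\<^sup>2 + B * real h)) * ee (real x * (real (n * h) * (2 * A)))" for x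
      unfolding f_def cnj_ee ee_add[symmetric]
      by (rule arg_cong[of _ _ ee]) (simp add: algebra_simps power2_eq_square)
    hence "norm (\<Sum>x<X - h. ee (real n * f (x + h)) * cnj (ee (real n * f x)))
        = norm (\<Sum>x<X - h. ee (real x * (real (n * h) * (2 * A))))"
      by (simp add: sum_distrib_left[symmetric] norm_mult)
    also have "\<dots> \<le> capped_inverse_sin X (real (n * h) * (2 * A))"
      by (rule norm_sum_ee_le_capped) auto
    finally show ?thesis .
  qed
  hence "Re (\<Sum>h = 1..<X. \<Sum>x<X - h. ee (real n * f (x + h)) * cnj (ee (real n * f x)))
      \<le> (\<Sum>h = 1..<X. capped_inverse_sin X (real (n * h) * (2 * A)))"
    by (intro order_trans[OF complex_Re_le_cmod] sum_norm_le)
  thus ?thesis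
    by (subst norm_sum_power2_eq_correlations) auto
qed

text \<open>
  Attach to each \<open>m\<close> the nearest integer \<open>r\<close> to \<open>m\<theta>\<close> and the integer \<open>j\<close> such that \<open>m\<theta> - r\<close> lies between \<open>j\<theta>\<close> and
  \<open>(j + 1)\<theta>\<close>. As consecutive points \<open>m\<theta>\<close> have distance \<open>\<theta>\<close>, the pair \<open>(r, j)\<close> determines \<open>m\<close>. At most
  \<open>M\<theta> + 2\<close> integers \<open>r\<close> occur, and for fixed \<open>r\<close> the summands are bounded by \<open>X\<close> for \<open>j = 0, -1\<close> and otherwise
  by \<open>1/(2\<theta>j)\<close> or \<open>1/(2\<theta>(-j - 1))\<close>, whose sum is harmonic.
\<close>

lemma sum_capped_inverse_sin_le:
  fixes \<theta> :: real
  assumes \<theta>: "0 < \<theta>" "\<theta> \<le> 1 / 2"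
  shows "(\<Sum>m = 1..M. capped_inverse_sin X (real m * \<theta>))
      \<le> (real M * \<theta> + 2) * (2 * real X + harm (nat \<lceil>1 / (2 * \<theta>)\<rceil>) / \<theta>)"
proof -
  define J where "J = nat \<lceil>1 / (2 * \<theta>)\<rceil>"
  define r where "r = (\<lambda>m::nat. round (real m * \<theta>))"
  define j where "j = (\<lambda>m::nat. \<lfloor>(real m * \<theta> - of_int (r m)) / \<theta>\<rfloor>)"
  \<comment> \<open>Below \<open>0\<close> the index is shifted by one: \<open>m\<theta> - r\<close> is then at distance at least \<open>(-i - 1)\<theta>\<close> from \<open>0\<close>.\<close>
  define G where "G = (\<lambda>i::int. if i = 0 \<or> i = -1 then real X else if i > 0 then 1 / (2 * \<theta> * of_int i)
      else 1 / (2 * \<theta> * of_int (- i - 1)))"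
  define Jset where "Jset = {0, -1} \<union> (int ` {1..J} \<union> (\<lambda>i. - int i - 1) ` {1..J})"
  have G_nonneg: "G i \<ge> 0" for i
    using \<theta> by (auto simp: G_def)
  have J1: "1 / (2 * \<theta>) \<le> real J"
    unfolding J_def by (rule real_nat_ceiling_ge)
  have rb: "\<bar>real m * \<theta> - of_int (r m)\<bar> \<le> 1 / 2" for m
    unfolding r_def using of_int_round_abs_le[of "real m * \<theta>"] by linarith
  have jm: "of_int (j m) * \<theta> \<le> real m * \<theta> - of_int (r m)"
           "real m * \<theta> - of_int (r m) < (of_int (j m) + 1) * \<theta>" for m
  proof -
    let ?q = "(real m * \<theta> - of_int (r m)) / \<theta>"
    have "of_int (j m) \<le> ?q" "?q < of_int (j m) + 1"
      unfolding j_def by linarith+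
    thus "of_int (j m) * \<theta> \<le> real m * \<theta> - of_int (r m)"
         "real m * \<theta> - of_int (r m) < (of_int (j m) + 1) * \<theta>"
      using \<theta> by (simp_all add: pos_le_divide_eq pos_divide_less_eq)
  qed
  have inj: "inj_on (\<lambda>m. (r m, j m)) {1..M}"
  proof (rule inj_onI)
    fix m m' assume "(r m, j m) = (r m', j m')"
    hence eq: "r m = r m'" "j m = j m'" by auto
    have "(real m - real m') * \<theta> < 1 * \<theta>" "(real m' - real m) * \<theta> < 1 * \<theta>"
      using jm[of m] jm[of m'] unfolding eq by (simp_all add: algebra_simps)
    hence "real m - real m' < 1" "real m' - real m < 1"
      using \<theta> by (simp_all only: mult_less_cancel_right_pos)
    thus "m = m'" by linarith
  qed
  have r_range: "r m \<in> {0..\<lfloor>real M * \<theta>\<rfloor> + 1}" if "m \<in> {1..M}" for m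
  proof -
    have "0 \<le> real m * \<theta>" "real m * \<theta> \<le> real M * \<theta>"
      using that \<theta> by (auto intro!: mult_right_mono)
    hence "round (0::real) \<le> r m" "r m \<le> round (real M * \<theta>)"
      unfolding r_def by (auto intro!: round_mono simp del: round_0)
    hence "0 \<le> r m" "r m \<le> round (real M * \<theta>)" by simp_all
    moreover have "round (real M * \<theta>) \<le> \<lfloor>real M * \<theta>\<rfloor> + 1"
      unfolding round_def by linarith
    ultimately show ?thesis by auto
  qed
  have j_range: "j m \<in> Jset" for m
  proof -
    have "of_int (j m) * \<theta> \<le> 1 / 2" "- (1 / 2) < (of_int (j m) + 1) * \<theta>"
      using jm[of m] rb[of m] by linarith+
    hence "of_int (j m) \<le> 1 / (2 * \<theta>)" "- (1 / (2 * \<theta>)) < of_int (j m) + 1"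
      using \<theta> by (simp_all add: field_simps)
    hence "of_int (j m) \<le> real J" "- real J < of_int (j m) + 1"
      using J1 by linarith+
    hence jj: "j m \<le> int J" "- int J < j m + 1" by linarith+
    consider "j m \<in> {0, -1}" | "j m > 0" | "j m < -1" by fastforce
    thus ?thesis
    proof cases
      case 2
      hence "j m = int (nat (j m))" "nat (j m) \<in> {1..J}" using jj by auto
      thus ?thesis unfolding Jset_def by blast
    next
      case 3
      hence "j m = - int (nat (- j m - 1)) - 1" "nat (- j m - 1) \<in> {1..J}" using jj by auto
      thus ?thesis unfolding Jset_def by blast
    qed (auto simp: Jset_def)
  qed
  have g_le: "capped_inverse_sin X (real m * \<theta>) \<le> G (j m)" for m
  proof -
    define u where "u = real m * \<theta> - of_int (r m)"
    have eq: "capped_inverse_sin X (real m * \<theta>) = capped_inverse_sin X u"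
      using capped_inverse_sin_add_of_int[of X u "r m"] by (simp add: u_def)
    have *: "capped_inverse_sin X u \<le> 1 / (2 * d)" if d: "d > 0" "d \<le> \<bar>u\<bar>" for d
    proof -
      have s: "2 * d \<le> \<bar>sin (pi * u)\<bar>"
        using abs_sin_pi_ge[of u] rb[of m] d by (simp add: u_def)
      hence "capped_inverse_sin X u \<le> 1 / \<bar>sin (pi * u)\<bar>"
        using d by (intro capped_inverse_sin_le_inverse) auto
      also have "\<dots> \<le> 1 / (2 * d)"
        using s d by (intro divide_left_mono) auto
      finally show ?thesis .
    qed
    consider "j m \<in> {0, -1}" | "j m > 0" | "j m < -1" by fastforce
    thus ?thesis
    proof cases
      case 1
      thus ?thesis by (auto simp: G_def capped_inverse_sin_le_cap)
    next
      case 2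
      have "capped_inverse_sin X u \<le> 1 / (2 * (of_int (j m) * \<theta>))"
        using jm(1)[of m] 2 \<theta> unfolding u_def[symmetric] by (intro *) auto
      thus ?thesis using 2 eq by (simp add: G_def mult_ac)
    next
      case 3
      have "(of_int (- j m - 1) :: real) > 0" using 3 by linarith
      hence pos: "of_int (- j m - 1) * \<theta> > 0"
        using \<theta> by (intro mult_pos_pos)
      have "of_int (- j m - 1) * \<theta> = - ((of_int (j m) + 1) * \<theta>)"
        by (simp add: algebra_simps)
      hence "of_int (- j m - 1) * \<theta> \<le> \<bar>u\<bar>"
        using jm(2)[of m] unfolding u_def[symmetric] by linarith
      with pos have "capped_inverse_sin X u \<le> 1 / (2 * (of_int (- j m - 1) * \<theta>))"
        by (rule *)
      thus ?thesis using 3 eq by (simp add: G_def mult_ac)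
    qed
  qed
  have sum_G: "(\<Sum>i\<in>Jset. G i) \<le> 2 * real X + harm J / \<theta>"
  proof -
    have pos: "(\<Sum>i\<in>int ` {1..J}. G i) = harm J / (2 * \<theta>)"
      by (subst sum.reindex) (auto simp: G_def harm_def sum_divide_distrib field_simps intro!: sum.cong)
    have neg: "(\<Sum>i\<in>(\<lambda>i. - int i - 1) ` {1..J}. G i) = harm J / (2 * \<theta>)"
      by (subst sum.reindex) (auto simp: G_def harm_def sum_divide_distrib field_simps inj_on_def intro!: sum.cong)
    have zero: "(\<Sum>i\<in>{0, -1}. G i) = 2 * real X"
      by (simp add: G_def)
    have "(\<Sum>i\<in>Jset. G i) = (\<Sum>i\<in>{0, -1}. G i) + ((\<Sum>i\<in>int ` {1..J}. G i) + (\<Sum>i\<in>(\<lambda>i. - int i - 1) ` {1..J}. G i))"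
      unfolding Jset_def by (subst sum.union_disjoint; (subst sum.union_disjoint)?) auto
    also have "\<dots> = 2 * real X + harm J / \<theta>"
      unfolding pos neg zero by (simp add: field_simps)
    finally show ?thesis by simp
  qed
  define Rset where "Rset = {0..\<lfloor>real M * \<theta>\<rfloor> + 1}"
  have "(\<Sum>m = 1..M. capped_inverse_sin X (real m * \<theta>)) \<le> (\<Sum>m = 1..M. G (j m))"
    by (intro sum_mono g_le)
  also have "\<dots> = (\<Sum>(s, i)\<in>(\<lambda>m. (r m, j m)) ` {1..M}. G i)"
    by (subst sum.reindex[OF inj]) simp
  also have "\<dots> \<le> (\<Sum>(s, i)\<in>Rset \<times> Jset. G i)"
    using r_range j_range by (intro sum_mono2) (auto simp: Rset_def Jset_def G_nonneg)
  also have "\<dots> = real (card Rset) * (\<Sum>i\<in>Jset. G i)"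
    by (simp add: sum.cartesian_product[symmetric])
  also have "real (card Rset) = of_int (\<lfloor>real M * \<theta>\<rfloor> + 2)"
    using \<theta> by (simp add: Rset_def)
  also have "of_int (\<lfloor>real M * \<theta>\<rfloor> + 2) * (\<Sum>i\<in>Jset. G i) \<le> (real M * \<theta> + 2) * (2 * real X + harm J / \<theta>)"
    using \<theta> by (intro mult_mono sum_G sum_nonneg G_nonneg) auto
  finally show ?thesis unfolding J_def .
qed

section \<open>The size of the divisor function\<close>

lemma card_divisors_prime_power_mult_le:
  fixes m p k :: nat
  assumes "prime p" "m > 0"
  shows "card {d. d dvd p ^ k * m} \<le> (k + 1) * card {d. d dvd m}"
proof -
  have "{d. d dvd p ^ k * m} \<subseteq> (\<lambda>(i, d). p ^ i * d) ` ({..k} \<times> {d. d dvd m})"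
  proof
    fix d assume "d \<in> {d. d dvd p ^ k * m}"
    then obtain d1 d2 where d: "d = d1 * d2" "d1 dvd p ^ k" "d2 dvd m"
      by (auto elim: dvd_productE)
    then obtain i where "i \<le> k" "d1 = p ^ i"
      using divides_primepow_nat[OF assms(1)] by blast
    thus "d \<in> (\<lambda>(i, d). p ^ i * d) ` ({..k} \<times> {d. d dvd m})"
      using d by force
  qed
  hence "card {d. d dvd p ^ k * m} \<le> card ((\<lambda>(i, d). p ^ i * d) ` ({..k} \<times> {d. d dvd m}))"
    using assms by (intro card_mono) (auto intro!: finite_imageI finite_divisors_nat)
  also have "\<dots> \<le> card ({..k} \<times> {d. d dvd m})"
    using assms by (intro card_image_le) (auto intro!: finite_divisors_nat)
  finally show ?thesis by (simp add: card_cartesian_product)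
qed

text \<open>
  By multiplicativity it suffices to compare the factor \<open>k + 1\<close> of a prime power \<open>p\<^sup>k\<close> with \<open>p\<^sup>k\<^sup>\<delta>\<close>. If
  \<open>p\<^sup>\<delta> \<ge> 2\<close> then \<open>k + 1 \<le> 2\<^sup>k \<le> p\<^sup>k\<^sup>\<delta>\<close>. For the remaining primes \<open>p\<^sup>k\<^sup>\<delta> \<ge> 2\<^sup>k\<^sup>\<delta> \<ge> 1 + k \<delta> ln 2\<close>, and
  the constant \<open>1 + 1/(\<delta> ln 2)\<close> makes up for the loss.
\<close>

lemma card_divisors_le_small_primes:
  fixes \<delta> :: real and n :: nat
  assumes \<delta>: "\<delta> > 0" and n: "n > 0"
  shows "real (card {d. d dvd n}) \<le>
    (1 + 1 / (\<delta> * ln 2)) ^ card {p. prime p \<and> p dvd n \<and> real p < 2 powr (1 / \<delta>)} * real n powr \<delta>"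
  using n
proof (induction n rule: less_induct)
  case (less n)
  define K where "K = 1 + 1 / (\<delta> * ln 2)"
  define S where "S = (\<lambda>n::nat. {p. prime p \<and> p dvd n \<and> real p < 2 powr (1 / \<delta>)})"
  have K1: "K \<ge> 1" using \<delta> by (simp add: K_def)
  have fin: "finite (S m)" if "m > 0" for m
    using finite_divisors_nat[OF that] by (rule rev_finite_subset) (auto simp: S_def)
  show ?case
  proof (cases "n = 1")
    case True
    have "S n = {}" using True by (auto simp: S_def)
    hence "K ^ card (S n) * real n powr \<delta> = 1" using True by simp
    thus ?thesis using True by (simp add: S_def K_def)
  next
    case False
    then obtain p where p: "prime p" "p dvd n"
      using prime_factor_nat by blast
    define k where "k = multiplicity p n"
    obtain m where m: "n = p ^ k * m" "\<not> p dvd m"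
      using multiplicity_decompose'[of n p] less.prems p not_prime_unit unfolding k_def by blast
    have p2: "p \<ge> 2" using p by (simp add: prime_ge_2_nat)
    have m0: "m > 0" using less.prems m by (cases m) auto
    have k0: "k > 0" using m p by (cases k) auto
    have "1 * m < p ^ k * m"
      using k0 p2 m0 one_less_power[of p k] by (intro mult_strict_right_mono) auto
    hence "m < n" using m by simp
    have IH: "real (card {d. d dvd m}) \<le> K ^ card (S m) * real m powr \<delta>"
      using less.IH[OF \<open>m < n\<close> m0] by (simp add: K_def S_def)
    have pk: "real (p ^ k) powr \<delta> = (real p powr \<delta>) ^ k"
      using p2 by (simp add: powr_realpow[symmetric] powr_powr mult.commute)
    have "real (k + 1) * K ^ card (S m) \<le> K ^ card (S n) * real (p ^ k) powr \<delta>"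
    proof (cases "real p < 2 powr (1 / \<delta>)")
      case True
      have "insert p (S m) \<subseteq> S n"
        using True p m by (auto simp: S_def)
      hence "card (insert p (S m)) \<le> card (S n)"
        using fin less.prems by (intro card_mono) auto
      moreover have "p \<notin> S m" using m by (auto simp: S_def)
      ultimately have "Suc (card (S m)) \<le> card (S n)"
        using fin[OF m0] by simp
      hence KK: "K ^ Suc (card (S m)) \<le> K ^ card (S n)"
        using K1 by (intro power_increasing) auto
      have "1 + real k * (\<delta> * ln 2) \<le> exp (real k * (\<delta> * ln 2))"
        by (rule exp_ge_add_one_self)
      also have "\<dots> = (2 powr \<delta>) ^ k"
        by (simp add: powr_def exp_of_nat_mult)
      also have "\<dots> \<le> (real p powr \<delta>) ^ k"
        using p2 \<delta> by (intro power_mono powr_mono2) auto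
      finally have "K * (1 + real k * (\<delta> * ln 2)) \<le> K * (real p powr \<delta>) ^ k"
        using K1 by (intro mult_left_mono) auto
      moreover have "real (k + 1) \<le> K * (1 + real k * (\<delta> * ln 2))"
      proof -
        have "K * (1 + real k * (\<delta> * ln 2)) = real k + 1 + (1 / (\<delta> * ln 2) + real k * (\<delta> * ln 2))"
          using \<delta> by (simp add: K_def field_simps)
        moreover have "0 \<le> 1 / (\<delta> * ln 2) + real k * (\<delta> * ln 2)" using \<delta> by simp
        ultimately show ?thesis by simp
      qed
      ultimately have "real (k + 1) \<le> K * (real p powr \<delta>) ^ k" by linarith
      hence "real (k + 1) * K ^ card (S m) \<le> K * (real p powr \<delta>) ^ k * K ^ card (S m)"
        using K1 by (intro mult_right_mono) auto
      also have "\<dots> = K ^ Suc (card (S m)) * (real p powr \<delta>) ^ k" by simp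
      also have "\<dots> \<le> K ^ card (S n) * (real p powr \<delta>) ^ k"
        by (intro mult_right_mono KK) auto
      finally show ?thesis using pk by simp
    next
      case False
      have "S m \<subseteq> S n" using m by (auto simp: S_def)
      hence "card (S m) \<le> card (S n)"
        using fin less.prems by (intro card_mono) auto
      hence KK: "K ^ card (S m) \<le> K ^ card (S n)"
        using K1 by (intro power_increasing) auto
      have "2 = (2 powr (1 / \<delta>)) powr \<delta>" using \<delta> by (simp add: powr_powr)
      also have "\<dots> \<le> real p powr \<delta>" using False \<delta> by (intro powr_mono2) auto
      finally have "2 ^ k \<le> (real p powr \<delta>) ^ k" by (intro power_mono) auto
      moreover have "real (k + 1) \<le> 2 ^ k"
        using less_exp[of k] by (metis Suc_eq_plus1 Suc_leI of_nat_le_numeral_power_cancel_iff)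
      ultimately have "real (k + 1) \<le> (real p powr \<delta>) ^ k" by linarith
      hence "real (k + 1) * K ^ card (S m) \<le> (real p powr \<delta>) ^ k * K ^ card (S n)"
        using K1 KK by (intro mult_mono) auto
      thus ?thesis using pk by (simp add: mult.commute)
    qed
    hence main: "real (k + 1) * K ^ card (S m) * real m powr \<delta> \<le> K ^ card (S n) * real (p ^ k) powr \<delta> * real m powr \<delta>"
      by (intro mult_right_mono) auto
    have "real (card {d. d dvd n}) \<le> real ((k + 1) * card {d. d dvd m})"
      unfolding m(1) using card_divisors_prime_power_mult_le[OF p(1) m0, of k] by (intro of_nat_mono)
    also have "\<dots> = real (k + 1) * real (card {d. d dvd m})" by (rule of_nat_mult)
    also have "\<dots> \<le> real (k + 1) * (K ^ card (S m) * real m powr \<delta>)"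
      by (intro mult_left_mono IH) auto
    also have "\<dots> \<le> K ^ card (S n) * (real (p ^ k) powr \<delta> * real m powr \<delta>)"
      using main by (simp only: mult.assoc)
    also have "real (p ^ k) powr \<delta> * real m powr \<delta> = real n powr \<delta>"
      by (simp add: m(1) powr_mult)
    finally show ?thesis by (simp add: K_def S_def)
  qed
qed

lemma card_divisors_le_powr:
  fixes \<delta> :: real and n :: nat
  assumes \<delta>: "\<delta> > 0" and n: "n > 0"
  shows "real (card {d. d dvd n}) \<le> (1 + 1 / (\<delta> * ln 2)) powr (2 powr (1 / \<delta>)) * real n powr \<delta>"
proof -
  define P where "P = 2 powr (1 / \<delta>)"
  define S where "S = {p. prime p \<and> p dvd n \<and> real p < P}"
  have "S \<subseteq> {1..nat \<lfloor>P\<rfloor>}"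
    by (auto simp: S_def le_nat_floor prime_gt_0_nat Suc_leI)
  hence "card S \<le> nat \<lfloor>P\<rfloor>"
    using card_mono[of "{1..nat \<lfloor>P\<rfloor>}" S] by simp
  moreover have "real (nat \<lfloor>P\<rfloor>) \<le> P"
    by (simp add: P_def)
  ultimately have S: "real (card S) \<le> P" by linarith
  have K: "1 + 1 / (\<delta> * ln 2) \<ge> 1" using \<delta> by simp
  have "(1 + 1 / (\<delta> * ln 2)) ^ card S = (1 + 1 / (\<delta> * ln 2)) powr real (card S)"
    by (subst powr_realpow) (use K in linarith, rule refl)
  also have "\<dots> \<le> (1 + 1 / (\<delta> * ln 2)) powr P"
    using K S by (intro powr_mono) auto
  finally have "(1 + 1 / (\<delta> * ln 2)) ^ card S * real n powr \<delta> \<le> (1 + 1 / (\<delta> * ln 2)) powr P * real n powr \<delta>"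
    by (intro mult_right_mono) auto
  with card_divisors_le_small_primes[OF assms] show ?thesis
    unfolding S_def P_def by linarith
qed

lemma ln_ge_1: "x \<ge> 3 \<Longrightarrow> ln (x::real) \<ge> 1"
  using ln3_gt_1 ln_mono[of 3 x] by linarith

lemma ln_ln_pos: "x \<ge> 3 \<Longrightarrow> ln (ln (x::real)) > 0"
  using ln3_gt_1 ln_mono[of 3 x] by (intro ln_gt_zero) linarith

text \<open>
  Wigert's bound, stated with an upper bound \<open>x\<close> for \<open>n\<close> on the right so that one value serves for all
  \<open>n \<le> x\<close>. Choose \<open>\<delta> = \<mu>/ln ln x\<close> in \<open>card_divisors_le_powr\<close> with \<open>\<mu>\<close> slightly above \<open>ln 2\<close>. Then
  \<open>n\<^sup>\<delta>\<close> gives the main term, while \<open>2\<^sup>1\<^sup>/\<^sup>\<delta>\<close> is a power of \<open>ln x\<close> with exponent \<open>c = (ln 2)/\<mu> < 1\<close>, so that the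
  contribution of the small primes is of lower order.
\<close>

lemma card_divisors_le_exp:
  fixes \<eta> :: real
  assumes \<eta>: "\<eta> > 0"
  shows "\<exists>C\<ge>1. \<forall>x\<ge>3. \<forall>n. 1 \<le> n \<and> real n \<le> x \<longrightarrow>
    real (card {d. d dvd n}) \<le> C * exp ((ln 2 + \<eta>) * ln x / ln (ln x))"
proof -
  \<comment> \<open>Half of \<open>\<eta>\<close> goes into the exponent of the main term and half absorbs the small primes.\<close>
  define \<mu> where "\<mu> = ln 2 + \<eta> / 2"
  define c where "c = ln 2 / \<mu>"
  define k where "k = 1 / (\<mu> * ln 2)"
  have \<mu>: "\<mu> > 0" unfolding \<mu>_def using \<eta> by (intro add_pos_pos) auto
  have c: "c > 0" "c < 1" using \<mu> \<eta> by (auto simp: c_def \<mu>_def field_simps)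
  have k: "k > 0" using \<mu> by (simp add: k_def)
  have "((\<lambda>y. y powr c * ln (1 + k * ln y) / (y / ln y)) \<longlongrightarrow> 0) at_top"
    using c k by real_asymp
  hence "eventually (\<lambda>y. y powr c * ln (1 + k * ln y) / (y / ln y) < \<eta> / 2) at_top"
    using \<eta> by (intro order_tendstoD) auto
  hence "eventually (\<lambda>y. y powr c * ln (1 + k * ln y) / (y / ln y) < \<eta> / 2 \<and> y > 1) at_top"
    using eventually_gt_at_top[of 1] by (rule eventually_conj)
  then obtain y0 where y0: "\<And>y. y \<ge> y0 \<Longrightarrow> y powr c * ln (1 + k * ln y) / (y / ln y) < \<eta> / 2 \<and> y > 1"
    by (auto simp: eventually_at_top_linorder)
  have large: "real (card {d. d dvd n}) \<le> exp ((ln 2 + \<eta>) * ln x / ln (ln x))"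
    if x: "x \<ge> 3" "ln x \<ge> y0" and n: "1 \<le> n" "real n \<le> x" for x :: real and n :: nat
  proof -
    define y where "y = ln x"
    have y: "y > 1" "y powr c * ln (1 + k * ln y) / (y / ln y) < \<eta> / 2"
      using y0[of y] x by (auto simp: y_def)
    have ly: "ln y > 0" using y by simp
    define \<delta> where "\<delta> = \<mu> / ln y"
    have \<delta>: "\<delta> > 0" using \<mu> ly by (simp add: \<delta>_def)
    have "real (card {d. d dvd n}) \<le> (1 + 1 / (\<delta> * ln 2)) powr (2 powr (1 / \<delta>)) * real n powr \<delta>"
      using n by (intro card_divisors_le_powr \<delta>) auto
    also have "2 powr (1 / \<delta>) = y powr c"
      using y ly \<mu> by (simp add: powr_def \<delta>_def c_def)
    also have "1 + 1 / (\<delta> * ln 2) = 1 + k * ln y"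
      using ly \<mu> by (simp add: \<delta>_def k_def field_simps)
    also have "(1 + k * ln y) powr (y powr c) = exp (y powr c * ln (1 + k * ln y))"
      using k ly by (simp add: powr_def add_pos_pos less_imp_neq[symmetric])
    also have "real n powr \<delta> \<le> x powr \<delta>"
      using n \<delta> by (intro powr_mono2) auto
    also have "x powr \<delta> = exp (\<mu> * y / ln y)"
      using x by (simp add: powr_def \<delta>_def y_def)
    finally have "real (card {d. d dvd n}) \<le> exp (y powr c * ln (1 + k * ln y) + \<mu> * y / ln y)"
      by (simp add: exp_add)
    also have "y powr c * ln (1 + k * ln y) \<le> (\<eta> / 2) * (y / ln y)"
    proof -
      have "y / ln y > 0" using y ly by simp
      thus ?thesis using y(2) by (simp only: pos_divide_less_eq less_imp_le)
    qed
    also have "(\<eta> / 2) * (y / ln y) + \<mu> * y / ln y = (ln 2 + \<eta>) * y / ln y"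
      using ly by (simp add: \<mu>_def field_simps)
    finally show ?thesis by (simp add: y_def)
  qed
  show ?thesis
  proof (intro exI[of _ "max 1 (exp y0)"] conjI allI impI)
    fix x :: real and n :: nat
    assume x: "x \<ge> 3" and n: "1 \<le> n \<and> real n \<le> x"
    have e1: "1 \<le> exp ((ln 2 + \<eta>) * ln x / ln (ln x))"
      using ln_ln_pos[OF x] ln_ge_1[OF x] \<eta> by simp
    show "real (card {d. d dvd n}) \<le> max 1 (exp y0) * exp ((ln 2 + \<eta>) * ln x / ln (ln x))"
    proof (cases "ln x \<ge> y0")
      case True
      have "1 * exp ((ln 2 + \<eta>) * ln x / ln (ln x)) \<le> max 1 (exp y0) * exp ((ln 2 + \<eta>) * ln x / ln (ln x))"
        by (intro mult_right_mono) auto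
      with large[OF x True, of n] n show ?thesis by linarith
    next
      case False
      have "card {d. d dvd n} \<le> n"
      proof -
        have "{d. d dvd n} \<subseteq> {1..n}"
          using n by (auto dest: dvd_imp_le intro: Suc_leI dvd_pos_nat)
        thus ?thesis using card_mono[of "{1..n}" "{d. d dvd n}"] by simp
      qed
      hence "real (card {d. d dvd n}) \<le> x" using n by linarith
      also have "x = exp (ln x)" using x by simp
      also have "\<dots> \<le> exp y0" using False by simp
      also have "\<dots> \<le> max 1 (exp y0) * 1" by simp
      also have "\<dots> \<le> max 1 (exp y0) * exp ((ln 2 + \<eta>) * ln x / ln (ln x))"
        by (intro mult_left_mono e1) auto
      finally show ?thesis .
    qed
  qed auto
qed

lemma ln_power3_le_exp:
  fixes \<eta> :: real
  assumes \<eta>: "\<eta> > 0"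
  shows "\<exists>C\<ge>1. \<forall>x\<ge>3. ln x ^ 3 \<le> C * exp (\<eta> * ln x / ln (ln x))"
proof -
  have "eventually (\<lambda>y::real. y ^ 3 \<le> exp (\<eta> * y / ln y) \<and> y > 1) at_top"
  proof (rule eventually_conj)
    show "eventually (\<lambda>y::real. y ^ 3 \<le> exp (\<eta> * y / ln y)) at_top"
      using \<eta> by real_asymp
  qed (rule eventually_gt_at_top)
  then obtain y0 where y0: "\<And>y. y \<ge> y0 \<Longrightarrow> y ^ 3 \<le> exp (\<eta> * y / ln y) \<and> y > 1"
    by (auto simp: eventually_at_top_linorder)
  show ?thesis
  proof (intro exI[of _ "max 1 (y0 ^ 3)"] conjI allI impI)
    fix x :: real assume x: "x \<ge> 3"
    have e1: "1 \<le> exp (\<eta> * ln x / ln (ln x))"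
      using ln_ln_pos[OF x] ln_ge_1[OF x] \<eta> by simp
    show "ln x ^ 3 \<le> max 1 (y0 ^ 3) * exp (\<eta> * ln x / ln (ln x))"
    proof (cases "ln x \<ge> y0")
      case True
      have "ln x ^ 3 \<le> 1 * exp (\<eta> * ln x / ln (ln x))" using y0[OF True] by simp
      also have "\<dots> \<le> max 1 (y0 ^ 3) * exp (\<eta> * ln x / ln (ln x))"
        by (intro mult_right_mono) auto
      finally show ?thesis .
    next
      case False
      have "ln x ^ 3 \<le> y0 ^ 3"
        using False ln_ge_1[OF x] by (intro power_mono) auto
      also have "\<dots> \<le> max 1 (y0 ^ 3) * 1" by simp
      also have "\<dots> \<le> max 1 (y0 ^ 3) * exp (\<eta> * ln x / ln (ln x))"
        by (intro mult_left_mono e1) auto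
      finally show ?thesis .
    qed
  qed auto
qed

section \<open>The mean square of quadratic exponential sums\<close>

lemma harm_le_1_plus_ln:
  assumes "n > 0"
  shows "harm n \<le> 1 + ln (real n)"
proof -
  obtain m where m: "n = Suc m" using assms by (cases n) auto
  have "harm (Suc m) - ln (real (Suc m)) \<le> harm (Suc 0) - ln (real (Suc 0))"
    using decseq_harm_diff_ln by (rule decseqD) simp
  thus ?thesis by (simp add: m harm_def)
qed

text \<open>
  Sort the pairs by their product: a pair with product \<open>m\<close> is determined by its first component, a divisor of
  \<open>m\<close>.
\<close>

lemma sum_products_le_card_divisors:
  fixes g :: "nat \<Rightarrow> real"
  assumes g: "\<And>m. g m \<ge> 0"
    and D: "\<And>m. 1 \<le> m \<Longrightarrow> m \<le> k * X \<Longrightarrow> real (card {d. d dvd m}) \<le> D"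
  shows "(\<Sum>n = 1..k. \<Sum>h = 1..<X. g (n * h)) \<le> D * (\<Sum>m = 1..k * X. g m)"
proof -
  define A where "A = {1..k} \<times> {1..<X}"
  have "(\<Sum>n = 1..k. \<Sum>h = 1..<X. g (n * h)) = (\<Sum>(n, h)\<in>A. g (n * h))"
    by (simp add: A_def sum.cartesian_product)
  also have "\<dots> = (\<Sum>m = 1..k * X. \<Sum>(n, h)\<in>{p \<in> A. fst p * snd p = m}. g (n * h))"
    by (rule sum.group[symmetric])
       (auto simp: A_def Suc_le_eq intro!: mult_le_mono)
  also have "\<dots> \<le> (\<Sum>m = 1..k * X. D * g m)"
  proof (rule sum_mono)
    fix m assume m: "m \<in> {1..k * X}"
    have "(\<Sum>(n, h)\<in>{p \<in> A. fst p * snd p = m}. g (n * h)) = (\<Sum>p\<in>{p \<in> A. fst p * snd p = m}. g m)"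
      by (intro sum.cong) auto
    also have "\<dots> = real (card {p \<in> A. fst p * snd p = m}) * g m" by simp
    also have "card {p \<in> A. fst p * snd p = m} \<le> card {d. d dvd m}"
    proof (rule card_inj_on_le[where f = fst])
      show "inj_on fst {p \<in> A. fst p * snd p = m}"
        by (rule inj_onI) (auto simp: A_def)
    qed (use m in \<open>auto intro: finite_divisors_nat\<close>)
    hence "real (card {p \<in> A. fst p * snd p = m}) * g m \<le> real (card {d. d dvd m}) * g m"
      by (intro mult_right_mono g) auto
    also have "\<dots> \<le> D * g m"
      using m by (intro mult_right_mono g D) auto
    finally show "(\<Sum>(n, h)\<in>{p \<in> A. fst p * snd p = m}. g (n * h)) \<le> D * g m" .
  qed
  finally show ?thesis by (simp add: sum_distrib_left)
qed

text \<open>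
  Summation by parts: the weight \<open>1/n\<close> turns a linear bound for the partial sums into a logarithmic one.
\<close>

lemma sum_divide_le_harm_of_partial_sums:
  fixes F :: "nat \<Rightarrow> real"
  assumes F: "\<And>k. 1 \<le> k \<Longrightarrow> k \<le> N \<Longrightarrow> (\<Sum>n = 1..k. F n) \<le> real k * B" and B: "B \<ge> 0"
  shows "(\<Sum>n = 1..N. F n / real n) \<le> (harm N + 1) * B"
proof -
  define T where "T = (\<lambda>k. \<Sum>n = 1..k. F n)"
  have eq: "(\<Sum>n = 1..M. F n / real n) = T M / real (M + 1) + (\<Sum>k = 1..M. T k / (real k * real (k + 1)))" for M
  proof (induction M)
    case (Suc M)
    have "T M / real (M + 1) + F (Suc M) / real (Suc M) = T (Suc M) / real (Suc M)"
      by (simp add: T_def add_divide_distrib)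
    also have "\<dots> = T (Suc M) / real (Suc M + 1) + T (Suc M) / (real (Suc M) * real (Suc M + 1))"
      by (simp add: divide_simps) (simp add: algebra_simps)
    finally show ?case using Suc by simp
  qed (simp add: T_def)
  have T: "T k / (real k * real (k + 1)) \<le> inverse (real k) * B" if "k \<in> {1..N}" for k
  proof -
    have "T k / (real k * real (k + 1)) \<le> (real k * B) / (real k * real (k + 1))"
      unfolding T_def using that by (intro divide_right_mono F) auto
    also have "\<dots> = B / real (k + 1)" using that by simp
    also have "\<dots> \<le> B / real k" using that B by (intro divide_left_mono) auto
    finally show ?thesis by (simp add: field_simps)
  qed
  have "T N / real (N + 1) \<le> B"
  proof (cases "N = 0")
    case False
    hence "T N \<le> real N * B" unfolding T_def by (intro F) auto
    also have "\<dots> \<le> B * real (N + 1)" using B by (simp add: algebra_simps)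
    finally show ?thesis by (simp add: divide_le_eq)
  qed (use B in \<open>simp add: T_def\<close>)
  moreover have "(\<Sum>k = 1..N. T k / (real k * real (k + 1))) \<le> (\<Sum>k = 1..N. inverse (real k) * B)"
    by (intro sum_mono T)
  ultimately show ?thesis
    unfolding eq by (simp add: harm_def sum_distrib_right distrib_right)
qed

text \<open>
  The Cauchy--Schwarz inequality with the weights \<open>1/n\<close>, followed by Weyl differencing. The linear bound for the
  partial sums that summation by parts requires uses \<open>kX\<theta> + 2 \<le> k(X\<theta> + 2)\<close> for \<open>k \<ge> 1\<close>.
\<close>

lemma sum_exponential_sums_quadratic_le:
  fixes A B0 C0 D :: real and N X :: nat
  defines "f \<equiv> (\<lambda>x::nat. A * (real x)\<^sup>2 + B0 * real x + C0)"
  defines "\<theta> \<equiv> 2 * \<bar>A\<bar>"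
  assumes \<theta>: "0 < \<theta>" "\<theta> \<le> 1 / 2"
    and D: "\<And>m. 1 \<le> m \<Longrightarrow> m \<le> N * X \<Longrightarrow> real (card {d. d dvd m}) \<le> D" and D0: "D \<ge> 0"
  shows "(\<Sum>n = 1..N. norm (\<Sum>x<X. ee (real n * f x)) / real n)\<^sup>2 \<le>
     harm N * (real X * harm N + 2 * (harm N + 1) *
       (D * ((real X * \<theta> + 2) * (2 * real X + harm (nat \<lceil>1 / (2 * \<theta>)\<rceil>) / \<theta>))))"
proof -
  define S where "S = (\<lambda>n. norm (\<Sum>x<X. ee (real n * f x)))"
  define g where "g = (\<lambda>m::nat. capped_inverse_sin X (real m * \<theta>))"
  define L where "L = 2 * real X + harm (nat \<lceil>1 / (2 * \<theta>)\<rceil>) / \<theta>"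
  define F where "F = (\<lambda>n. \<Sum>h = 1..<X. g (n * h))"
  have L0: "L \<ge> 0" using \<theta> by (simp add: L_def harm_nonneg)
  have g_nonneg: "g m \<ge> 0" for m
    by (simp add: g_def capped_inverse_sin_nonneg)
  have g_eq: "capped_inverse_sin X (real m * (2 * A)) = g m" for m
  proof (cases "A \<ge> 0")
    case False
    thus ?thesis using capped_inverse_sin_minus[of X "real m * (2 * A)"] by (simp add: g_def \<theta>_def)
  qed (simp add: g_def \<theta>_def)
  have S_le: "(S n)\<^sup>2 \<le> real X + 2 * F n" for n
    using weyl_differencing_quadratic[of n A B0 C0 X] unfolding S_def F_def f_def g_eq .
  have F_sum: "(\<Sum>n = 1..k. F n) \<le> real k * (D * ((real X * \<theta> + 2) * L))" if k: "1 \<le> k" "k \<le> N" for k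
  proof -
    have "(\<Sum>n = 1..k. F n) \<le> D * (\<Sum>m = 1..k * X. g m)"
      unfolding F_def
    proof (rule sum_products_le_card_divisors[OF g_nonneg])
      fix m assume "1 \<le> m" "m \<le> k * X"
      moreover have "k * X \<le> N * X" using k by simp
      ultimately show "real (card {d. d dvd m}) \<le> D" by (intro D order.trans[of m "k * X" "N * X"])
    qed
    also have "\<dots> \<le> D * ((real (k * X) * \<theta> + 2) * L)"
      unfolding g_def L_def by (intro mult_left_mono sum_capped_inverse_sin_le \<theta> D0)
    also have "\<dots> \<le> D * ((real k * (real X * \<theta> + 2)) * L)"
    proof -
      have "real (k * X) * \<theta> + 2 \<le> real k * (real X * \<theta> + 2)"
        using k by (simp add: algebra_simps)
      thus ?thesis by (intro mult_left_mono mult_right_mono D0 L0)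
    qed
    finally show ?thesis by (simp only: mult_ac)
  qed
  have "(\<Sum>n = 1..N. S n / real n) = (\<Sum>n = 1..N. (1 / sqrt (real n)) * (S n / sqrt (real n)))"
    by (intro sum.cong) auto
  hence "(\<Sum>n = 1..N. S n / real n)\<^sup>2 \<le>
      (\<Sum>n = 1..N. (1 / sqrt (real n))\<^sup>2) * (\<Sum>n = 1..N. (S n / sqrt (real n))\<^sup>2)"
    using Cauchy_Schwarz_ineq_sum by metis
  also have "(\<Sum>n = 1..N. (1 / sqrt (real n))\<^sup>2) = harm N"
    unfolding harm_def by (intro sum.cong) (auto simp: power_divide inverse_eq_divide)
  also have "(\<Sum>n = 1..N. (S n / sqrt (real n))\<^sup>2) = (\<Sum>n = 1..N. (S n)\<^sup>2 / real n)"
    by (intro sum.cong) (auto simp: power_divide)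
  also have "harm N * (\<Sum>n = 1..N. (S n)\<^sup>2 / real n) \<le> harm N * (\<Sum>n = 1..N. (real X + 2 * F n) / real n)"
    by (intro mult_left_mono sum_mono divide_right_mono S_le harm_nonneg) auto
  also have "(\<Sum>n = 1..N. (real X + 2 * F n) / real n) = real X * harm N + 2 * (\<Sum>n = 1..N. F n / real n)"
    by (simp add: harm_def add_divide_distrib sum.distrib sum_distrib_left inverse_eq_divide)
  also have "harm N * (real X * harm N + 2 * (\<Sum>n = 1..N. F n / real n))
      \<le> harm N * (real X * harm N + 2 * ((harm N + 1) * (D * ((real X * \<theta> + 2) * L))))"
    using \<theta> D0 L0
    by (intro mult_left_mono add_left_mono sum_divide_le_harm_of_partial_sums F_sum harm_nonneg) auto
  finally show ?thesis unfolding S_def L_def by (simp only: mult.assoc)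
qed

section \<open>The lattice point error of the parabola\<close>

lemma parabola_error_eq_sum_sawtooth:
  "parabola_error \<alpha> \<beta> \<gamma> a b =
     - (\<Sum>x<nat \<lfloor>b\<rfloor>. sawtooth (dilated_parabola \<alpha> \<beta> \<gamma> a (real x + 1)))"
proof -
  have "{x. 1 \<le> x \<and> real_of_int x \<le> b} = (\<lambda>x. int x + 1) ` {..<nat \<lfloor>b\<rfloor>}"
  proof (intro equalityI subsetI)
    fix x assume "x \<in> {x. 1 \<le> x \<and> real_of_int x \<le> b}"
    hence "1 \<le> x" "x \<le> \<lfloor>b\<rfloor>" by (simp_all add: le_floor_iff)
    hence "x = int (nat (x - 1)) + 1" "nat (x - 1) \<in> {..<nat \<lfloor>b\<rfloor>}"
      unfolding lessThan_iff by linarith+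
    thus "x \<in> (\<lambda>x. int x + 1) ` {..<nat \<lfloor>b\<rfloor>}" by (rule image_eqI)
  next
    fix x assume "x \<in> (\<lambda>x. int x + 1) ` {..<nat \<lfloor>b\<rfloor>}"
    hence "1 \<le> x" "x \<le> \<lfloor>b\<rfloor>" by auto
    thus "x \<in> {x. 1 \<le> x \<and> real_of_int x \<le> b}" by (simp add: le_floor_iff)
  qed
  hence *: "(\<Sum>x | 1 \<le> x \<and> real_of_int x \<le> b. h x) = (\<Sum>x<nat \<lfloor>b\<rfloor>. h (int x + 1))" for h :: "int \<Rightarrow> real"
    by (simp add: sum.reindex inj_on_def)
  show ?thesis
    unfolding parabola_error_def *
    unfolding sum_subtractf[symmetric] sum_negf[symmetric]
    by (intro sum.cong) (simp_all add: sawtooth_def)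
qed

lemma parabola_error_trivial:
  assumes "b > 0"
  shows "\<bar>parabola_error \<alpha> \<beta> \<gamma> a b\<bar> \<le> b"
proof -
  have "\<bar>sawtooth t\<bar> \<le> 1" for t
    unfolding sawtooth_def by linarith
  hence "\<bar>\<Sum>x<nat \<lfloor>b\<rfloor>. sawtooth (dilated_parabola \<alpha> \<beta> \<gamma> a (real x + 1))\<bar> \<le> (\<Sum>x<nat \<lfloor>b\<rfloor>. 1)"
    by (intro order_trans[OF sum_abs] sum_mono)
  thus ?thesis
    using assms unfolding parabola_error_eq_sum_sawtooth by (simp, linarith)
qed

text \<open>
  For \<open>N = \<lfloor>b/R\<rfloor>\<close> the two parts of \<open>sum_sawtooth_le\<close> balance: \<open>X/N \<le> 2R\<close>, and the main factor of the mean
  square is \<open>(X\<theta> + 2)(2X + L/\<theta>)\<close>, which is of order \<open>L(b\<^sup>2/a + b + a)\<close> and hence of order \<open>L R\<^sup>2\<close>, where \<open>L\<close> is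
  logarithmic. The products \<open>nh\<close> stay below \<open>NX \<le> b\<^sup>2/R\<close>. As \<open>\<surd>a \<le> R \<le> b\<close> and hence
  \<open>\<surd>a \<le> b\<^sup>2/R\<close>, all logarithms, also that of \<open>a\<close>, are bounded by multiples of \<open>ln x\<close>.
\<close>

lemma parabola_error_le_polylog:
  fixes \<alpha> \<beta> \<gamma> a b x D R :: real
  defines "K \<equiv> 2 + 12 * (3 + ln (1 + 1 / (4 * \<bar>\<alpha>\<bar>))) * (5 + 4 * \<bar>\<alpha>\<bar> + 1 / \<bar>\<alpha>\<bar>)"
  defines "R \<equiv> sqrt a + b / sqrt a"
  assumes \<alpha>: "\<alpha> \<noteq> 0" and a: "a > 1" "4 * \<bar>\<alpha>\<bar> \<le> a" and b: "b > 1" "R \<le> b"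
    and x: "x \<ge> 3" "b\<^sup>2 / R \<le> x"
    and D: "\<And>m. 1 \<le> m \<Longrightarrow> real m \<le> x \<Longrightarrow> real (card {d. d dvd m}) \<le> D"
  shows "\<bar>parabola_error \<alpha> \<beta> \<gamma> a b\<bar> \<le> (33 * sqrt K + 32) * ln x ^ 3 * sqrt D * R"
proof -
  define X where "X = nat \<lfloor>b\<rfloor>"
  define N where "N = nat \<lfloor>b / R\<rfloor>"
  define l where "l = ln x"
  define \<theta> where "\<theta> = 2 * \<bar>\<alpha> / a\<bar>"
  define c where "c = ln (1 + 1 / (4 * \<bar>\<alpha>\<bar>))"
  define L where "L = (harm (nat \<lceil>1 / (2 * \<theta>)\<rceil>) :: real)"
  define h where "h = (harm N :: real)"
  define W where "W = (\<Sum>n = 1..N. norm (\<Sum>x<X. ee (real n * dilated_parabola \<alpha> \<beta> \<gamma> a (real x + 1))) / real n)"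
  have l1: "l \<ge> 1" unfolding l_def by (rule ln_ge_1[OF x(1)])
  have D1: "D \<ge> 1" using D[of 1] x by simp
  have A0: "\<bar>\<alpha>\<bar> > 0" using \<alpha> by simp
  have c0: "c \<ge> 0" unfolding c_def using A0 by simp
  have R_ge: "R \<ge> sqrt a" unfolding R_def using a b by simp
  have R0: "R > 0" using R_ge a by (smt (verit) real_sqrt_gt_zero)
  have R_sq: "R\<^sup>2 = a + 2 * b + b\<^sup>2 / a"
    using a by (simp add: R_def power2_sum power_divide)
  have X: "real X \<le> b" "real X \<ge> 1"
    unfolding X_def using b by (linarith, simp add: le_floor_iff)
  have bR: "b / R \<ge> 1" using b R0 by simp
  have N: "real N \<le> b / R" "b / R < real N + 1" "N \<ge> 1"
    unfolding N_def using bR by (linarith, linarith, simp add: le_nat_iff le_floor_iff)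
  have NX: "real (N * X) \<le> x"
  proof -
    have "real (N * X) \<le> (b / R) * b"
      unfolding of_nat_mult using N X b R0 by (intro mult_mono) auto
    also have "\<dots> = b\<^sup>2 / R" by (simp add: power2_eq_square)
    finally show ?thesis using x by linarith
  qed
  have N_le: "real N \<le> x"
  proof -
    have "real N * 1 \<le> real N * real X" using X by (intro mult_left_mono) auto
    thus ?thesis using NX by simp
  qed
  have a_le: "a \<le> x\<^sup>2"
  proof -
    have "sqrt a \<le> b" using R_ge b by linarith
    also have "b * 1 \<le> b * (b / R)" using bR b by (intro mult_left_mono) auto
    hence "b \<le> b\<^sup>2 / R" by (simp add: power2_eq_square)
    finally have "sqrt a \<le> x" using x by linarith
    hence "(sqrt a)\<^sup>2 \<le> x\<^sup>2" using a by (intro power_mono) auto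
    thus ?thesis using a by simp
  qed
  have \<theta>_eq: "\<theta> = 2 * \<bar>\<alpha>\<bar> / a" using a by (simp add: \<theta>_def abs_divide)
  have \<theta>: "0 < \<theta>" "\<theta> \<le> 1 / 2" using A0 a by (simp_all add: \<theta>_eq)
  have h: "0 \<le> h" "h \<le> 2 * l"
  proof -
    have "h \<le> 1 + ln (real N)" unfolding h_def using N by (intro harm_le_1_plus_ln) auto
    also have "ln (real N) \<le> l" unfolding l_def using N N_le by simp
    finally show "h \<le> 2 * l" using l1 by linarith
  qed (simp add: h_def harm_nonneg)
  have L: "0 \<le> L" "L \<le> (3 + c) * l"
  proof -
    define J where "J = nat \<lceil>1 / (2 * \<theta>)\<rceil>"
    have "1 / (2 * \<theta>) = a / (4 * \<bar>\<alpha>\<bar>)" by (simp add: \<theta>_eq)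
    moreover have "1 / (2 * \<theta>) > 0" using \<theta> by simp
    ultimately have J: "real J \<le> a / (4 * \<bar>\<alpha>\<bar>) + 1" "J > 0"
      unfolding J_def by linarith+
    have "1 \<le> x\<^sup>2" using x by (simp add: one_le_power)
    moreover have "a / (4 * \<bar>\<alpha>\<bar>) \<le> x\<^sup>2 / (4 * \<bar>\<alpha>\<bar>)" using a_le by (intro divide_right_mono) auto
    ultimately have "real J \<le> x\<^sup>2 + x\<^sup>2 / (4 * \<bar>\<alpha>\<bar>)" using J by linarith
    also have "\<dots> = x\<^sup>2 * (1 + 1 / (4 * \<bar>\<alpha>\<bar>))" by (simp add: algebra_simps)
    finally have "ln (real J) \<le> ln (x\<^sup>2 * (1 + 1 / (4 * \<bar>\<alpha>\<bar>)))"
      using J by simp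
    also have "\<dots> = 2 * l + c"
    proof -
      have "1 + 1 / (4 * \<bar>\<alpha>\<bar>) > 0" using A0 by (intro add_pos_pos) auto
      thus ?thesis using x by (simp add: ln_mult ln_realpow l_def c_def)
    qed
    finally have "L \<le> 1 + (2 * l + c)"
      using harm_le_1_plus_ln[OF J(2)] unfolding L_def J_def by linarith
    moreover have "c \<le> c * l" using l1 c0 mult_left_mono[of 1 l c] by simp
    ultimately show "L \<le> (3 + c) * l" using l1 by (simp add: distrib_right)
  qed (simp add: L_def harm_nonneg)
  define L' where "L' = (3 + c) * l"
  have L'1: "L' \<ge> 1"
  proof -
    have "1 * 1 \<le> (3 + c) * l" using l1 c0 by (intro mult_mono) auto
    thus ?thesis by (simp add: L'_def)
  qed
  \<comment> \<open>The factor by which \<open>(b\<theta> + 2)(2b + 1/\<theta>)\<close> can exceed \<open>R\<^sup>2 = a + 2b + b\<^sup>2/a\<close>, read off term by term.\<close>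
  define K0 where "K0 = 5 + 4 * \<bar>\<alpha>\<bar> + 1 / \<bar>\<alpha>\<bar>"
  have K_eq: "K = 2 + 12 * (3 + c) * K0" by (simp add: K_def c_def K0_def)
  have K0: "K0 \<ge> 0" using A0 by (simp add: K0_def)
  have K2: "K \<ge> 2" using K0 c0 by (simp add: K_eq)
  have prod: "(real X * \<theta> + 2) * (2 * real X + L / \<theta>) \<le> L' * (K0 * R\<^sup>2)"
  proof -
    have "(real X * \<theta> + 2) * (2 * real X + L / \<theta>) \<le> (b * \<theta> + 2) * (2 * b + L' / \<theta>)"
      using X L \<theta> b unfolding L'_def
      by (intro mult_mono add_mono divide_right_mono mult_right_mono mult_left_mono add_nonneg_nonneg) auto
    also have "\<dots> \<le> (b * \<theta> + 2) * (L' * (2 * b + 1 / \<theta>))"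
    proof -
      have "2 * b \<le> L' * (2 * b)" using L'1 b mult_right_mono[of 1 L' "2 * b"] by simp
      hence "2 * b + L' / \<theta> \<le> L' * (2 * b + 1 / \<theta>)" by (simp add: distrib_left)
      thus ?thesis using b \<theta> by (intro mult_left_mono) auto
    qed
    also have "\<dots> = L' * ((b * \<theta> + 2) * (2 * b + 1 / \<theta>))" by simp
    also have "(b * \<theta> + 2) * (2 * b + 1 / \<theta>) = 4 * \<bar>\<alpha>\<bar> * (b\<^sup>2 / a) + 5 * b + (1 / \<bar>\<alpha>\<bar>) * a"
      using A0 a by (simp add: \<theta>_eq field_simps power2_eq_square)
    also have "\<dots> \<le> K0 * (b\<^sup>2 / a) + K0 * (2 * b) + K0 * a"
    proof (intro add_mono mult_right_mono)
      show "5 * b \<le> K0 * (2 * b)"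
        using A0 b mult_right_mono[of 5 "2 * K0" b] by (simp add: K0_def)
    qed (use A0 a in \<open>auto simp: K0_def\<close>)
    also have "\<dots> = K0 * R\<^sup>2" by (simp add: R_sq algebra_simps)
    finally show ?thesis using L'1 by simp
  qed
  have W0: "W \<ge> 0" unfolding W_def by (intro sum_nonneg) auto
  have W_sq: "W\<^sup>2 \<le> K * l ^ 3 * D * R\<^sup>2"
  proof -
    have "dilated_parabola \<alpha> \<beta> \<gamma> a (real x + 1)
        = (\<alpha> / a) * (real x)\<^sup>2 + (2 * \<alpha> / a + \<beta>) * real x + (\<alpha> / a + \<beta> + \<gamma> * a)" for x :: nat
      by (simp add: dilated_parabola_def power2_sum algebra_simps add_divide_distrib)
    moreover have "real (card {d. d dvd m}) \<le> D" if "1 \<le> m" "m \<le> N * X" for m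
      using that NX of_nat_mono[OF that(2), where ?'a = real] by (intro D) linarith+
    ultimately have "W\<^sup>2 \<le> h * (real X * h + 2 * (h + 1) * (D * ((real X * \<theta> + 2) * (2 * real X + L / \<theta>))))"
      unfolding W_def h_def L_def \<theta>_def
      using \<theta> D1
      by (simp only:, intro sum_exponential_sums_quadratic_le) (auto simp: \<theta>_def)
    also have "\<dots> \<le> (2 * l) * ((R\<^sup>2 / 2) * (2 * l) + 2 * (2 * l + 1) * (D * (L' * (K0 * R\<^sup>2))))"
    proof -
      have "real X \<le> R\<^sup>2 / 2"
      proof -
        have "b\<^sup>2 / a \<ge> 0" using a by simp
        hence "2 * real X \<le> R\<^sup>2" using X a unfolding R_sq by linarith
        thus ?thesis by simp
      qed
      hence Xh: "real X * h \<le> (R\<^sup>2 / 2) * (2 * l)"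
        using h by (intro mult_mono) auto
      have Q0: "0 \<le> (real X * \<theta> + 2) * (2 * real X + L / \<theta>)"
        using \<theta> L by (intro mult_nonneg_nonneg add_nonneg_nonneg) auto
      have "2 * (h + 1) * (D * Q) \<le> 2 * (2 * l + 1) * (D * Q')" if "0 \<le> Q" "Q \<le> Q'" for Q Q'
        using that h l1 D1 by (intro mult_mono) auto
      note hQ = this[OF Q0 prod]
      have "0 \<le> real X * h + 2 * (h + 1) * (D * Q)" if "0 \<le> Q" for Q
        using h D1 that by (intro add_nonneg_nonneg mult_nonneg_nonneg) auto
      note nonneg = this[OF Q0]
      have "0 \<le> 2 * l" using l1 by simp
      from mult_mono[OF h(2) add_mono[OF Xh hQ] this nonneg] show ?thesis .
    qed
    also have "\<dots> \<le> (2 * l) * (l\<^sup>2 * D * R\<^sup>2 + 2 * (3 * l) * (D * (L' * (K0 * R\<^sup>2))))"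
    proof -
      have "(R\<^sup>2 / 2) * (2 * l) = l * 1 * R\<^sup>2" by simp
      also have "\<dots> \<le> l\<^sup>2 * D * R\<^sup>2"
        using l1 D1 by (intro mult_mono) (auto simp: power2_eq_square)
      finally have "(R\<^sup>2 / 2) * (2 * l) \<le> l\<^sup>2 * D * R\<^sup>2" .
      moreover have "2 * (2 * l + 1) * (D * (L' * (K0 * R\<^sup>2))) \<le> 2 * (3 * l) * (D * (L' * (K0 * R\<^sup>2)))"
        using l1 D1 L'1 K0 by (intro mult_right_mono) auto
      ultimately show ?thesis
        using l1 by (intro mult_left_mono add_mono) auto
    qed
    also have "\<dots> = K * l ^ 3 * D * R\<^sup>2"
      by (simp add: K_eq L'_def algebra_simps power2_eq_square power3_eq_cube)
    finally show ?thesis .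
  qed
  have W_le: "W \<le> sqrt K * l\<^sup>2 * sqrt D * R"
  proof (rule power2_le_imp_le)
    have "l ^ 3 \<le> l ^ 4" using l1 by (intro power_increasing) auto
    hence "K * l ^ 3 * D * R\<^sup>2 \<le> K * l ^ 4 * D * R\<^sup>2"
      using K2 D1 by (intro mult_right_mono mult_left_mono) auto
    also have "\<dots> = (sqrt K * l\<^sup>2 * sqrt D * R)\<^sup>2"
      using K2 D1 by (simp add: power_mult_distrib)
    finally show "W\<^sup>2 \<le> (sqrt K * l\<^sup>2 * sqrt D * R)\<^sup>2" using W_sq by linarith
  qed (use K2 D1 R0 in auto)
  have "\<bar>parabola_error \<alpha> \<beta> \<gamma> a b\<bar> \<le> (1 + 16 * h) * W + 8 * h * real X / real N"
    unfolding parabola_error_eq_sum_sawtooth h_def W_def X_def abs_minus_cancel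
    using N by (intro sum_sawtooth_le) auto
  also have "(1 + 16 * h) * W \<le> (33 * l) * (sqrt K * l\<^sup>2 * sqrt D * R)"
    using h l1 W0 W_le by (intro mult_mono) auto
  also have "8 * h * real X / real N \<le> 32 * (l ^ 3 * sqrt D * R)"
  proof -
    have "b \<le> 2 * R * real N"
    proof -
      have "b / R \<le> 2 * real N" using N by linarith
      thus ?thesis using R0 by (simp add: divide_le_eq mult_ac)
    qed
    hence "real X / real N \<le> 2 * R" using X N by (simp add: divide_le_eq)
    hence "8 * h * (real X / real N) \<le> 8 * (2 * l) * (2 * R)"
      using h l1 by (intro mult_mono) auto
    also have "\<dots> = 32 * (l * 1 * R)" by simp
    also have "l * 1 * R \<le> l ^ 3 * sqrt D * R"
      using l1 D1 R0 power_increasing[of 1 3 l] by (intro mult_right_mono mult_mono) auto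
    finally show ?thesis by simp
  qed
  also have "(33 * l) * (sqrt K * l\<^sup>2 * sqrt D * R) + 32 * (l ^ 3 * sqrt D * R)
      = (33 * sqrt K + 32) * l ^ 3 * sqrt D * R"
    by (simp add: algebra_simps power2_eq_square power3_eq_cube)
  finally show ?thesis by (simp add: l_def)
qed

theorem theorem1:
  fixes \<alpha> \<beta> \<gamma> \<epsilon> :: real
  assumes "\<alpha> \<noteq> 0" and "\<epsilon> > 0"
  shows "\<exists>C>0. \<forall>a>1. \<forall>b>1.
    \<bar>parabola_error \<alpha> \<beta> \<gamma> a b\<bar> \<le>
      C * (a powr (1 / 2) + b * a powr (- 1 / 2)) *
      exp ((1 / 2 * ln 2 + \<epsilon>) * ln (Delta a b) / ln (ln (Delta a b)))"
proof -
  obtain C1 where C1: "C1 \<ge> 1" "\<And>x n. x \<ge> 3 \<Longrightarrow> 1 \<le> n \<Longrightarrow> real n \<le> x \<Longrightarrow>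
      real (card {d. d dvd n}) \<le> C1 * exp ((ln 2 + \<epsilon>) * ln x / ln (ln x))"
    using card_divisors_le_exp[OF assms(2)] by metis
  obtain C2 where C2: "C2 \<ge> 1" "\<And>x::real. x \<ge> 3 \<Longrightarrow> ln x ^ 3 \<le> C2 * exp (\<epsilon> / 2 * ln x / ln (ln x))"
    using ln_power3_le_exp[of "\<epsilon> / 2"] assms(2) by auto
  define K where "K = 2 + 12 * (3 + ln (1 + 1 / (4 * \<bar>\<alpha>\<bar>))) * (5 + 4 * \<bar>\<alpha>\<bar> + 1 / \<bar>\<alpha>\<bar>)"
  define C3 where "C3 = (33 * sqrt K + 32) * C2 * sqrt C1"
  have "K \<ge> 0"
    unfolding K_def by (intro add_nonneg_nonneg mult_nonneg_nonneg) (auto intro!: ln_ge_zero)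
  hence C3: "C3 \<ge> 0" using C1 C2 by (simp add: C3_def)
  \<comment> \<open>One summand for each of the cases \<open>b < R\<close>, \<open>a < 4\<bar>\<alpha>\<bar>\<close> and the remaining one.\<close>
  define C where "C = 1 + 2 * sqrt \<bar>\<alpha>\<bar> + C3"
  have C: "C > 0" "C \<ge> 1" "C \<ge> 2 * sqrt \<bar>\<alpha>\<bar>" "C \<ge> C3"
  proof -
    have "sqrt \<bar>\<alpha>\<bar> \<ge> 0" by simp
    thus "C > 0" "C \<ge> 1" "C \<ge> 2 * sqrt \<bar>\<alpha>\<bar>" "C \<ge> C3" unfolding C_def using C3 by linarith+
  qed
  show ?thesis
  proof (intro exI[of _ C] conjI allI impI)
    fix a b :: real assume a: "a > 1" and b: "b > 1"
    define R where "R = sqrt a + b / sqrt a"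
    define x where "x = Delta a b"
    define E where "E = exp ((1 / 2 * ln 2 + \<epsilon>) * ln x / ln (ln x))"
    have R_eq: "a powr (1 / 2) + b * a powr (- 1 / 2) = R"
      using a by (simp add: R_def powr_half_sqrt powr_minus_divide)
    have R0: "R > 0" using a b by (simp add: R_def add_pos_pos)
    have x3: "x \<ge> 3" by (simp add: x_def Delta_def)
    have xR: "b\<^sup>2 / R \<le> x"
    proof -
      have "R = (a + b) / sqrt a" using a by (simp add: R_def field_simps)
      hence "b\<^sup>2 / R = b\<^sup>2 * a powr (1 / 2) / (a + b)"
        using a by (simp add: powr_half_sqrt)
      thus ?thesis by (simp add: x_def Delta_def)
    qed
    have E1: "E \<ge> 1"
      using ln_ln_pos[OF x3] ln_ge_1[OF x3] assms(2) by (simp add: E_def)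
    have triv: "\<bar>parabola_error \<alpha> \<beta> \<gamma> a b\<bar> \<le> C * R * E" if "b \<le> C * R"
    proof -
      have "\<bar>parabola_error \<alpha> \<beta> \<gamma> a b\<bar> \<le> C * R * 1"
        using parabola_error_trivial[of b \<alpha> \<beta> \<gamma> a] b that by simp
      also have "\<dots> \<le> C * R * E"
        using C R0 E1 by (intro mult_left_mono) auto
      finally show ?thesis .
    qed
    have "\<bar>parabola_error \<alpha> \<beta> \<gamma> a b\<bar> \<le> C * R * E"
    proof -
      consider "a < 4 * \<bar>\<alpha>\<bar>" | "b < R" | "4 * \<bar>\<alpha>\<bar> \<le> a" "R \<le> b" by linarith
      thus ?thesis
      proof cases
        case 1
        have "sqrt a \<le> sqrt (4 * \<bar>\<alpha>\<bar>)" using 1 by simp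
        also have "\<dots> = 2 * sqrt \<bar>\<alpha>\<bar>" by (simp add: real_sqrt_mult)
        also have "\<dots> \<le> C" by (rule C)
        finally have "b = sqrt a * (b / sqrt a) \<and> sqrt a \<le> C" using a by simp
        hence "b \<le> C * (b / sqrt a)" using a b by (metis divide_nonneg_nonneg less_imp_le mult_right_mono real_sqrt_ge_zero zero_less_one order.strict_trans)
        also have "\<dots> \<le> C * R" using C a b by (intro mult_left_mono) (auto simp: R_def)
        finally show ?thesis by (rule triv)
      next
        case 2
        have "1 * R \<le> C * R" using C R0 by (intro mult_right_mono) auto
        thus ?thesis using 2 by (intro triv) simp
      next
        case 3
        define D where "D = C1 * exp ((ln 2 + \<epsilon>) * ln x / ln (ln x))"
        have "\<bar>parabola_error \<alpha> \<beta> \<gamma> a b\<bar> \<le> (33 * sqrt K + 32) * ln x ^ 3 * sqrt D * R"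
          unfolding K_def R_def
        proof (rule parabola_error_le_polylog)
          show "real (card {d. d dvd m}) \<le> D" if "1 \<le> m" "real m \<le> x" for m
            unfolding D_def using C1(2)[OF x3 that] .
        qed (use assms a b 3 x3 xR in \<open>auto simp: R_def\<close>)
        also have "sqrt D = sqrt C1 * exp ((1 / 2 * ln 2 + \<epsilon> / 2) * ln x / ln (ln x))"
        proof -
          have "exp ((ln 2 + \<epsilon>) * ln x / ln (ln x)) = (exp ((1 / 2 * ln 2 + \<epsilon> / 2) * ln x / ln (ln x)))\<^sup>2"
            by (simp add: exp_double[symmetric] algebra_simps add_divide_distrib)
          thus ?thesis by (simp add: D_def real_sqrt_mult)
        qed
        also have "(33 * sqrt K + 32) * ln x ^ 3 * (sqrt C1 * exp ((1 / 2 * ln 2 + \<epsilon> / 2) * ln x / ln (ln x))) * R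
           \<le> (33 * sqrt K + 32) * (C2 * exp (\<epsilon> / 2 * ln x / ln (ln x))) * (sqrt C1 * exp ((1 / 2 * ln 2 + \<epsilon> / 2) * ln x / ln (ln x))) * R"
          using C1(1) R0 \<open>K \<ge> 0\<close> by (intro mult_right_mono mult_left_mono C2 x3) auto
        also have "\<dots> = C3 * R * E"
        proof -
          have "exp (\<epsilon> / 2 * ln x / ln (ln x)) * exp ((1 / 2 * ln 2 + \<epsilon> / 2) * ln x / ln (ln x)) = E"
            unfolding E_def exp_add[symmetric] by (rule arg_cong[of _ _ exp])
                 (use ln_ln_pos[OF x3] in \<open>simp add: field_simps\<close>)
          thus ?thesis by (simp add: C3_def mult_ac)
        qed
        also have "\<dots> \<le> C * R * E"
          using C R0 E1 by (intro mult_right_mono) auto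
        finally show ?thesis .
      qed
    qed
    thus "\<bar>parabola_error \<alpha> \<beta> \<gamma> a b\<bar> \<le>
      C * (a powr (1 / 2) + b * a powr (- 1 / 2)) *
      exp ((1 / 2 * ln 2 + \<epsilon>) * ln (Delta a b) / ln (ln (Delta a b)))"
      unfolding R_eq E_def x_def .
  qed (rule C)
qed

end
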